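(* Let $G$ be a canonical acyclic directed mixed graph with finite vertex set $V$, let $\mathsf P$ be the distribution of a non-singular Gaussian linear system with respect to $G$ with weight function $\sigma$ and positive definite noise covariance $\Lambda$, and let $\{V_j\},\{V_k\},L\subset V$ be disjoint. Put $\tilde V=\{V_j,V_k\}\cup L$ and let $\tilde G$ be the marginal graph of $G$ on $\tilde V$. Consider the following two conditions on $\tilde G$: (a) every path from $V_j$ to $V_k$ in $\tilde G$ that is not blocked by $L$ is equal to the single edge $V_j\to V_k$; (b) there is no right-directed walk from $V_k$ to a vertex of $L$ in $\tilde G$. Then (a) and (b) both hold if and only if the following three conditions all hold: 1. every path from $V_j$ to $V_k$ in $G$ that is not ancestrally blocked by $L$ is right-directed; 2. there is no right-directed walk from $V_k$ to a vertex of $L$ in $G$; 3. there does not exist $V_l\in V\setminus\tilde V$ such that there is a right-directed walk from $V_j$ to $V_k$ in $G$ having $V_l$ as a non-endpoint and not blocked by $L$, and there is a right-directed walk in $G$ from $V_l$ to a vertex of $L$. Moreover, if conditions 1--3 hold, then $$\gamma(V_k,V_j\mid L)=\sigma\big(\{\text{right-directed paths from } V_j \text{ to } V_k \text{ in } G \text{ not blocked by } L\}\big).$$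
   Context: A directed mixed graph $G=(V,\mathcal D,\mathcal B)$ consists of a finite vertex set $V=\{V_1,\dots,V_d\}$, a set $\mathcal D\subseteq V\times V$ of directed edges ($(a,b)\in\mathcal D$ is written $a\to b$) and a symmetric set $\mathcal B\subseteq V\times V$ of bidirected edges ($a\leftrightarrow b$); loops are allowed in general. $G$ is canonical if $a\leftrightarrow a$ for every $a\in V$. A walk from $a$ to $b$ is a sequence $a=v_0,e_1,v_1,\dots,e_n,v_n=b$, $n\ge 1$, where each $e_i$ is an edge $v_{i-1}\to v_i$, $v_{i-1}\leftarrow v_i$ (a directed edge $v_i\to v_{i-1}$ traversed backwards) or $v_{i-1}\leftrightarrow v_i$. Its non-endpoints are the entries at positions $v_1,\dots,v_{n-1}$. A path is a walk without repeated vertices. A right-directed walk has all edges of the form $\to$; $G$ is acyclic if there is no right-directed walk from a vertex to itself. A trek is a walk consisting of a (possibly empty) sequence of edges $\leftarrow$, then exactly one bidirected edge, then a (possibly empty) sequence of edges $\to$. A non-endpoint $v_i$ is a collider on the walk if both $e_i$ and $e_{i+1}$ have an arrowhead at $v_i$. A walk is blocked by $L\subseteq V$ if it contains a collider not in $L$, or a non-endpoint in $L$ that is not a collider. A walk in $G$ is ancestrally blocked by $L$ if it contains a collider $v$ such that $v\notin L$ and there is no right-directed walk in $G$ from $v$ to a vertex of $L$, or a non-endpoint in $L$ that is not a collider. Marginal graph: for $\tilde V\subseteq V$, the marginal graph $\tilde G$ of $G$ has vertex set $\tilde V$; for $a,b\in\tilde V$, $a\to b$ in $\tilde G$ iff there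 is a right-directed walk from $a$ to $b$ in $G$ with no non-endpoint in $\tilde V$, and $a\leftrightarrow b$ in $\tilde G$ iff there is a trek from $a$ to $b$ in $G$ with no non-endpoint in $\tilde V$. Gaussian linear systems: vertices are identified with the components of a random vector $V=(V_1,\dots,V_d)$. A weight function $\sigma$ assigns a real number to each edge of $G$ (the same for $a\leftrightarrow b$ and $b\leftrightarrow a$; zero weights are permitted) and determines matrices by $\beta_{ab}=\sigma(a\to b)$ if $a\to b$ in $G$ and $0$ otherwise, $\Lambda_{ab}=\sigma(a\leftrightarrow b)$ if $a\leftrightarrow b$ in $G$ and $0$ otherwise. The Gaussian linear system is $V=\beta^TV+E$ with $E\sim\mathrm N(0,\Lambda)$; it is non-singular if $\mathrm{Id}-\beta$ is invertible, and then $V\sim\mathrm N(0,(\mathrm{Id}-\beta)^{-T}\Lambda(\mathrm{Id}-\beta)^{-1})$. The weight of a walk is the product of its edge weights and the weight of a set of walks is the sum of the weights of its elements ($0$ for the empty set). Regression coefficient: $\gamma(V_k,V_j\mid L)=\mathrm{Cov}(V_k,V_j\mid L)/\mathrm{Var}(V_j\mid L)$ under $\mathsf P$, i.e. the coefficient of $V_j$ in the linear regression of $V_k$ on $V_j$ and $L$; equivalently $-(\tilde\Sigma^{-1})_{jk}/(\tilde\Sigma^{-1})_{kk}$, where $\tilde\Sigma$ is the covariance matrix of $(V_j,V_k,L)$. *)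

theory Defs
  imports "HOL-Probability.Probability"
begin

record 'v mixed_graph =
  verts :: "'v set"
  dir_edges :: "('v \<times> 'v) set"
  bidir_edges :: "('v \<times> 'v) set"

definition mixed_graph :: "'v mixed_graph \<Rightarrow> bool" where
  "mixed_graph G \<longleftrightarrow>
     finite (verts G) \<and>
     dir_edges G \<subseteq> verts G \<times> verts G \<and>
     bidir_edges G \<subseteq> verts G \<times> verts G \<and>
     sym (bidir_edges G)"

definition canonical :: "'v mixed_graph \<Rightarrow> bool" where
  "canonical G \<longleftrightarrow> (\<forall>a\<in>verts G. (a, a) \<in> bidir_edges G)"

(* A walk is a list of steps (u, t, v) from u to v; the tag t says whether the edge is
   u -> v, u <- v (the directed edge from v to u traversed backwards), or u <-> v. *)

datatype edge_type = Forward | Backward | Bidirected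

type_synonym 'v step = "'v \<times> edge_type \<times> 'v"
type_synonym 'v walk = "'v step list"

fun src :: "'v step \<Rightarrow> 'v" where "src (u, t, v) = u"
fun tag :: "'v step \<Rightarrow> edge_type" where "tag (u, t, v) = t"
fun tgt :: "'v step \<Rightarrow> 'v" where "tgt (u, t, v) = v"

fun step_in :: "'v mixed_graph \<Rightarrow> 'v step \<Rightarrow> bool" where
  "step_in G (u, Forward, v) \<longleftrightarrow> (u, v) \<in> dir_edges G"
| "step_in G (u, Backward, v) \<longleftrightarrow> (v, u) \<in> dir_edges G"
| "step_in G (u, Bidirected, v) \<longleftrightarrow> (u, v) \<in> bidir_edges G"

definition is_walk :: "'v mixed_graph \<Rightarrow> 'v \<Rightarrow> 'v \<Rightarrow> 'v walk \<Rightarrow> bool" where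
  "is_walk G a b w \<longleftrightarrow>
     w \<noteq> [] \<and> src (hd w) = a \<and> tgt (last w) = b \<and>
     (\<forall>s\<in>set w. step_in G s) \<and>
     (\<forall>i. Suc i < length w \<longrightarrow> tgt (w ! i) = src (w ! Suc i))"

definition walk_verts :: "'v walk \<Rightarrow> 'v list" where
  "walk_verts w = src (hd w) # map tgt w"

definition is_path :: "'v mixed_graph \<Rightarrow> 'v \<Rightarrow> 'v \<Rightarrow> 'v walk \<Rightarrow> bool" where
  "is_path G a b w \<longleftrightarrow> is_walk G a b w \<and> distinct (walk_verts w)"

(* Position i refers to the i-th entry v_i of the vertex sequence v_0, ..., v_n; the edge
   entering it is step i - 1 and the edge leaving it is step i. *)

definition non_endpoint_positions :: "'v walk \<Rightarrow> nat set" where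
  "non_endpoint_positions w = {0<..<length w}"

definition non_endpoints :: "'v walk \<Rightarrow> 'v set" where
  "non_endpoints w = (\<lambda>i. walk_verts w ! i) ` non_endpoint_positions w"

definition right_directed :: "'v walk \<Rightarrow> bool" where
  "right_directed w \<longleftrightarrow> (\<forall>s\<in>set w. tag s = Forward)"

definition right_directed_walk :: "'v mixed_graph \<Rightarrow> 'v \<Rightarrow> 'v \<Rightarrow> 'v walk \<Rightarrow> bool" where
  "right_directed_walk G a b w \<longleftrightarrow> is_walk G a b w \<and> right_directed w"

definition acyclic_graph :: "'v mixed_graph \<Rightarrow> bool" where
  "acyclic_graph G \<longleftrightarrow> \<not> (\<exists>a w. right_directed_walk G a a w)"

definition is_trek :: "'v mixed_graph \<Rightarrow> 'v \<Rightarrow> 'v \<Rightarrow> 'v walk \<Rightarrow> bool" where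
  "is_trek G a b w \<longleftrightarrow> is_walk G a b w \<and>
     (\<exists>l m r. w = l @ [m] @ r \<and> (\<forall>s\<in>set l. tag s = Backward) \<and>
        tag m = Bidirected \<and> (\<forall>s\<in>set r. tag s = Forward))"

definition collider_at :: "'v walk \<Rightarrow> nat \<Rightarrow> bool" where
  "collider_at w i \<longleftrightarrow> i \<in> non_endpoint_positions w \<and>
     tag (w ! (i - 1)) \<in> {Forward, Bidirected} \<and> tag (w ! i) \<in> {Backward, Bidirected}"

definition blocked :: "'v set \<Rightarrow> 'v walk \<Rightarrow> bool" where
  "blocked L w \<longleftrightarrow>
     (\<exists>i\<in>non_endpoint_positions w. collider_at w i \<and> walk_verts w ! i \<notin> L) \<or>
     (\<exists>i\<in>non_endpoint_positions w. \<not> collider_at w i \<and> walk_verts w ! i \<in> L)"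

definition ancestor_of :: "'v mixed_graph \<Rightarrow> 'v \<Rightarrow> 'v set \<Rightarrow> bool" where
  "ancestor_of G v L \<longleftrightarrow> (\<exists>m\<in>L. \<exists>w. right_directed_walk G v m w)"

definition ancestrally_blocked :: "'v mixed_graph \<Rightarrow> 'v set \<Rightarrow> 'v walk \<Rightarrow> bool" where
  "ancestrally_blocked G L w \<longleftrightarrow>
     (\<exists>i\<in>non_endpoint_positions w. collider_at w i \<and> walk_verts w ! i \<notin> L \<and>
        \<not> ancestor_of G (walk_verts w ! i) L) \<or>
     (\<exists>i\<in>non_endpoint_positions w. \<not> collider_at w i \<and> walk_verts w ! i \<in> L)"

definition marginal_graph :: "'v mixed_graph \<Rightarrow> 'v set \<Rightarrow> 'v mixed_graph" where
  "marginal_graph G W =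
     \<lparr> verts = W,
       dir_edges = {(a, b). a \<in> W \<and> b \<in> W \<and>
         (\<exists>w. right_directed_walk G a b w \<and> non_endpoints w \<inter> W = {})},
       bidir_edges = {(a, b). a \<in> W \<and> b \<in> W \<and>
         (\<exists>w. is_trek G a b w \<and> non_endpoints w \<inter> W = {})} \<rparr>"


datatype 'v edge = Dir 'v 'v | Bidir 'v 'v

(* Values of the weight function on non-edges are never used. *)

definition weight_function :: "'v mixed_graph \<Rightarrow> ('v edge \<Rightarrow> real) \<Rightarrow> bool" where
  "weight_function G \<sigma> \<longleftrightarrow> (\<forall>(a, b)\<in>bidir_edges G. \<sigma> (Bidir a b) = \<sigma> (Bidir b a))"

fun step_edge :: "'v step \<Rightarrow> 'v edge" where
  "step_edge (u, Forward, v) = Dir u v"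
| "step_edge (u, Backward, v) = Dir v u"
| "step_edge (u, Bidirected, v) = Bidir u v"

definition walk_weight :: "('v edge \<Rightarrow> real) \<Rightarrow> 'v walk \<Rightarrow> real" where
  "walk_weight \<sigma> w = (\<Prod>s\<leftarrow>w. \<sigma> (step_edge s))"

definition walks_weight :: "('v edge \<Rightarrow> real) \<Rightarrow> 'v walk set \<Rightarrow> real" where
  "walks_weight \<sigma> A = (\<Sum>w\<in>A. walk_weight \<sigma> w)"

definition coeff_matrix ::
    "'v::finite mixed_graph \<Rightarrow> ('v edge \<Rightarrow> real) \<Rightarrow> real ^ 'v ^ 'v" where
  "coeff_matrix G \<sigma> = (\<chi> a b. if (a, b) \<in> dir_edges G then \<sigma> (Dir a b) else 0)"

definition noise_cov ::
    "'v::finite mixed_graph \<Rightarrow> ('v edge \<Rightarrow> real) \<Rightarrow> real ^ 'v ^ 'v" where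
  "noise_cov G \<sigma> = (\<chi> a b. if (a, b) \<in> bidir_edges G then \<sigma> (Bidir a b) else 0)"

definition positive_definite :: "real ^ 'n ^ 'n \<Rightarrow> bool" where
  "positive_definite A \<longleftrightarrow> transpose A = A \<and> (\<forall>x. x \<noteq> 0 \<longrightarrow> x \<bullet> (A *v x) > 0)"

(* The random vector E is N(0, C): every linear combination c . E is univariate normal with
   mean 0 and variance c . C c, the normal law of variance 0 being the point mass at 0. *)

definition centered_normal ::
    "'m measure \<Rightarrow> ('m \<Rightarrow> real ^ 'n) \<Rightarrow> real ^ 'n ^ 'n \<Rightarrow> bool" where
  "centered_normal M E C \<longleftrightarrow> transpose C = C \<and> E \<in> borel_measurable M \<and>
     (\<forall>c. (c \<bullet> (C *v c) = 0 \<and> (AE \<omega> in M. c \<bullet> E \<omega> = 0)) \<or>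
          (c \<bullet> (C *v c) > 0 \<and>
           distributed M lborel (\<lambda>\<omega>. c \<bullet> E \<omega>) (normal_density 0 (sqrt (c \<bullet> (C *v c))))))"

definition gaussian_linear_system ::
    "'v::finite mixed_graph \<Rightarrow> ('v edge \<Rightarrow> real) \<Rightarrow> 'm measure \<Rightarrow>
     ('m \<Rightarrow> real ^ 'v) \<Rightarrow> ('m \<Rightarrow> real ^ 'v) \<Rightarrow> bool" where
  "gaussian_linear_system G \<sigma> M X E \<longleftrightarrow>
     prob_space M \<and> weight_function G \<sigma> \<and> X \<in> borel_measurable M \<and>
     centered_normal M E (noise_cov G \<sigma>) \<and>
     (\<forall>\<omega>\<in>space M. X \<omega> = transpose (coeff_matrix G \<sigma>) *v X \<omega> + E \<omega>)"

definition non_singular :: "'v::finite mixed_graph \<Rightarrow> ('v edge \<Rightarrow> real) \<Rightarrow> bool" where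
  "non_singular G \<sigma> \<longleftrightarrow> invertible (mat 1 - coeff_matrix G \<sigma>)"

(* Population least-squares regression of component k on the components in S, with
   intercept c and coefficients b; only the values of b on S matter. *)

definition linear_regression ::
    "(real ^ 'v) measure \<Rightarrow> 'v::finite \<Rightarrow> 'v set \<Rightarrow> real \<Rightarrow> ('v \<Rightarrow> real) \<Rightarrow> bool" where
  "linear_regression P k S c b \<longleftrightarrow>
     (\<forall>c' b'. (\<integral>x. (x $ k - (c + (\<Sum>s\<in>S. b s * x $ s)))\<^sup>2 \<partial>P)
            \<le> (\<integral>x. (x $ k - (c' + (\<Sum>s\<in>S. b' s * x $ s)))\<^sup>2 \<partial>P))"

(* For Gaussian P this is Cov(V_k, V_j | L) / Var(V_j | L). *)

definition regression_coeff ::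
    "(real ^ 'v) measure \<Rightarrow> 'v::finite \<Rightarrow> 'v \<Rightarrow> 'v set \<Rightarrow> real" where
  "regression_coeff P k j L =
     (THE g. \<exists>c b. linear_regression P k (insert j L) c b \<and> b j = g)"

end

theory Submission
  imports Defs
begin

text \<open>
  Both sets of conditions are compared with a third one. Call a vertex of \<open>L\<close> reached if the
  marginal graph has a path to it from \<open>j\<close> with all non-endpoints colliders in \<open>L\<close> and an arrowhead
  at the end. The third condition says that in the marginal graph \<open>k\<close> has no child and that there is
  no edge \<open>u \<leftrightarrow> k\<close> with \<open>u = j\<close> or \<open>u\<close> reached. It follows from (a) and (b) directly.
  It implies 1--3 by following a path in \<open>G\<close> from \<open>j\<close> and recording how its current vertex is
  connected to \<open>j\<close> or to a reached vertex. Conversely, an unblocked path of the marginal graph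
  expands to a walk in \<open>G\<close>, and cutting out its loops gives a path that violates 1 or 3.

  For the regression coefficient, the variables in \<open>{j, k} \<union> L\<close> satisfy the linear system of the
  marginal graph, whose coefficients are the weights of directed walks outside the set and whose
  noise is correlated only along its bidirected edges. As \<open>k\<close> has no child, the noise of \<open>k\<close>
  can be projected on the noise of the vertices of \<open>L\<close> that are not reached; since \<open>j\<close> is neither
  one of these nor a parent of one, only the direct edge contributes to the coefficient of \<open>j\<close>.
\<close>

section \<open>Walks\<close>

text \<open>A relation between adjacent steps instead of a predicate on positions, so that blocking
  becomes a \<open>successively\<close> condition, which splits under Cons and append.\<close>

definition collides :: "'v step \<Rightarrow> 'v step \<Rightarrow> bool" where
  "collides s s' \<longleftrightarrow> tag s \<in> {Forward, Bidirected} \<and> tag s' \<in> {Backward, Bidirected}"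

lemma is_walk_iff:
  "is_walk G a b w \<longleftrightarrow> w \<noteq> [] \<and> src (hd w) = a \<and> tgt (last w) = b \<and>
     (\<forall>s\<in>set w. step_in G s) \<and> successively (\<lambda>s s'. tgt s = src s') w"
  by (simp add: is_walk_def successively_conv_nth)

lemma is_walk_Nil [simp]: "\<not> is_walk G a b []"
  by (simp add: is_walk_def)

lemma is_walk_Cons:
  "is_walk G a b (s # w) \<longleftrightarrow> src s = a \<and> step_in G s \<and>
     (if w = [] then tgt s = b else is_walk G (tgt s) b w)"
  by (auto simp: is_walk_iff successively_Cons)

lemma is_walk_append:
  assumes "is_walk G a b w" and "is_walk G b c w'"
  shows "is_walk G a c (w @ w')"
  using assms by (auto simp: is_walk_iff successively_append_iff)

lemma non_endpoint_tgt:
  assumes "i \<in> non_endpoint_positions w"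
  shows "walk_verts w ! i = tgt (w ! (i - 1))"
  using assms by (cases i) (auto simp: non_endpoint_positions_def walk_verts_def)

lemma collider_at_iff:
  assumes "i \<in> non_endpoint_positions w"
  shows "collider_at w i \<longleftrightarrow> collides (w ! (i - 1)) (w ! i)"
  using assms by (simp add: collider_at_def collides_def)

lemma ball_non_endpoint_positions:
  "(\<forall>i\<in>non_endpoint_positions w. P (w ! (i - 1)) (w ! i)) \<longleftrightarrow> successively P w"
proof
  assume *: "\<forall>i\<in>non_endpoint_positions w. P (w ! (i - 1)) (w ! i)"
  show "successively P w"
    unfolding successively_conv_nth
  proof (intro allI impI)
    fix i assume "Suc i < length w"
    then show "P (w ! i) (w ! Suc i)"
      using *[rule_format, of "Suc i"] by (simp add: non_endpoint_positions_def)
  qed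
next
  assume *: "successively P w"
  show "\<forall>i\<in>non_endpoint_positions w. P (w ! (i - 1)) (w ! i)"
  proof
    fix i assume "i \<in> non_endpoint_positions w"
    then show "P (w ! (i - 1)) (w ! i)"
      using successively_nth[OF *, of "i - 1"] by (simp add: non_endpoint_positions_def)
  qed
qed

lemma not_blocked_iff:
  "\<not> blocked L w \<longleftrightarrow> successively (\<lambda>s s'. collides s s' \<longleftrightarrow> tgt s \<in> L) w"
  unfolding ball_non_endpoint_positions[symmetric] blocked_def
  using non_endpoint_tgt[of _ w] collider_at_iff[of _ w] by metis

lemma not_ancestrally_blocked_iff:
  "\<not> ancestrally_blocked G L w \<longleftrightarrow>
     successively (\<lambda>s s'. if collides s s' then tgt s \<in> L \<or> ancestor_of G (tgt s) L
                          else tgt s \<notin> L) w"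
  unfolding ball_non_endpoint_positions[symmetric] ancestrally_blocked_def
  using non_endpoint_tgt[of _ w] collider_at_iff[of _ w] by (smt (verit))

text \<open>Position \<open>i\<close> of the vertex sequence is the target of step
  \<open>i - 1\<close>, so the last step contributes only the endpoint.\<close>

lemma non_endpoints_eq: "non_endpoints w = tgt ` set (butlast w)"
proof -
  have "non_endpoints w = (\<lambda>i. tgt (w ! (i - 1))) ` {0<..<length w}"
    unfolding non_endpoints_def using non_endpoint_tgt[of _ w]
    by (force simp: non_endpoint_positions_def)
  also have "\<dots> = (\<lambda>i. tgt (w ! i)) ` {..<length w - 1}"
  proof (intro equalityI subsetI)
    fix x assume "x \<in> (\<lambda>i. tgt (w ! (i - 1))) ` {0<..<length w}"
    then obtain i where "0 < i" "i < length w" "x = tgt (w ! (i - 1))" by auto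
    then show "x \<in> (\<lambda>i. tgt (w ! i)) ` {..<length w - 1}"
      by (intro image_eqI[of _ _ "i - 1"]) auto
  next
    fix x assume "x \<in> (\<lambda>i. tgt (w ! i)) ` {..<length w - 1}"
    then obtain i where "i < length w - 1" "x = tgt (w ! i)" by auto
    then show "x \<in> (\<lambda>i. tgt (w ! (i - 1))) ` {0<..<length w}"
      by (intro image_eqI[of _ _ "Suc i"]) auto
  qed
  also have "\<dots> = tgt ` set (butlast w)"
    by (force simp: set_conv_nth nth_butlast image_iff)
  finally show ?thesis .
qed

lemma successively_tgt_iff:
  "successively (\<lambda>s s'. tgt s \<in> A) w \<longleftrightarrow> tgt ` set (butlast w) \<subseteq> A"
  by (induction w) (auto simp: successively_Cons)

section \<open>Right-directed walks and reachability\<close>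

lemma right_directed_trancl:
  assumes "right_directed_walk G a b w"
  shows "(a, b) \<in> (dir_edges G)\<^sup>+"
  using assms
proof (induction w arbitrary: a)
  case Nil
  then show ?case by (simp add: right_directed_walk_def is_walk_def)
next
  case (Cons s w)
  obtain u t v where s: "s = (u, t, v)" by (cases s)
  with Cons.prems have "(a, v) \<in> dir_edges G" and "if w = [] then v = b else right_directed_walk G v b w"
    by (auto simp: right_directed_walk_def is_walk_Cons right_directed_def)
  with Cons.IH[of v] show ?case
    by (auto split: if_splits intro: trancl_into_trancl2)
qed

lemma trancl_right_directed:
  assumes "(a, b) \<in> (dir_edges G)\<^sup>+"
  shows "\<exists>w. right_directed_walk G a b w"
  using assms
proof (induction rule: trancl_induct)
  case (base y)
  then have "right_directed_walk G a y [(a, Forward, y)]"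
    by (simp add: right_directed_walk_def is_walk_iff right_directed_def)
  then show ?case by blast
next
  case (step y z)
  then obtain w where "right_directed_walk G a y w" by blast
  moreover have "right_directed_walk G y z [(y, Forward, z)]"
    using step by (simp add: right_directed_walk_def is_walk_iff right_directed_def)
  ultimately have "right_directed_walk G a z (w @ [(y, Forward, z)])"
    by (auto simp: right_directed_walk_def right_directed_def intro: is_walk_append)
  then show ?case by blast
qed

lemma ex_right_directed_walk:
  "(\<exists>w. right_directed_walk G a b w) \<longleftrightarrow> (a, b) \<in> (dir_edges G)\<^sup>+"
  using right_directed_trancl trancl_right_directed by metis

lemma ancestor_of_iff: "ancestor_of G v L \<longleftrightarrow> (\<exists>m\<in>L. (v, m) \<in> (dir_edges G)\<^sup>+)"
  by (simp add: ancestor_of_def ex_right_directed_walk)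

lemma acyclic_graph_iff: "acyclic_graph G \<longleftrightarrow> acyclic (dir_edges G)"
  by (simp add: acyclic_graph_def ex_right_directed_walk acyclic_def)

lemma right_directed_not_blocked_iff:
  assumes "right_directed w"
  shows "\<not> blocked L w \<longleftrightarrow> tgt ` set (butlast w) \<inter> L = {}"
proof -
  have "\<not> collides s s'" if "s' \<in> set w" for s s'
    using assms that by (auto simp: right_directed_def collides_def)
  then have "\<not> blocked L w \<longleftrightarrow> successively (\<lambda>s s'. tgt s \<in> - L) w"
    unfolding not_blocked_iff by (intro successively_cong) auto
  then show ?thesis
    unfolding successively_tgt_iff by blast
qed

lemma right_directed_not_ancestrally_blocked_iff:
  assumes "right_directed w"
  shows "\<not> ancestrally_blocked G L w \<longleftrightarrow> tgt ` set (butlast w) \<inter> L = {}"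
proof -
  have "\<not> collides s s'" if "s' \<in> set w" for s s'
    using assms that by (auto simp: right_directed_def collides_def)
  then have "\<not> ancestrally_blocked G L w \<longleftrightarrow> successively (\<lambda>s s'. tgt s \<in> - L) w"
    unfolding not_ancestrally_blocked_iff by (intro successively_cong) auto
  then show ?thesis
    unfolding successively_tgt_iff by blast
qed

lemma right_directed_walk_split:
  assumes "right_directed_walk G a b w" and "l \<in> tgt ` set (butlast w)"
  obtains w1 w2 where "w = w1 @ w2" "right_directed_walk G a l w1" "right_directed_walk G l b w2"
proof -
  obtain s where s: "s \<in> set (butlast w)" "l = tgt s" using assms(2) by auto
  then obtain p q where pq: "butlast w = p @ s # q" by (meson split_list)
  have "w \<noteq> []" using s by auto
  define r where "r = q @ [last w]"
  have w: "w = (p @ [s]) @ r"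
    using pq \<open>w \<noteq> []\<close> by (metis r_def append.assoc append_Cons append_Nil append_butlast_last_id)
  have "r \<noteq> []" by (simp add: r_def)
  then have "right_directed_walk G a l (p @ [s])" "right_directed_walk G l b r"
    using assms(1) s(2) unfolding w
    by (auto simp: right_directed_walk_def right_directed_def is_walk_iff successively_append_iff
        successively_Cons hd_append)
  with w that show thesis by blast
qed

section \<open>Reversal of walks\<close>

fun flip_step :: "'v step \<Rightarrow> 'v step" where
  "flip_step (u, Forward, v) = (v, Backward, u)"
| "flip_step (u, Backward, v) = (v, Forward, u)"
| "flip_step (u, Bidirected, v) = (v, Bidirected, u)"

lemma flip_step_simps [simp]:
  "src (flip_step s) = tgt s" "tgt (flip_step s) = src s"
  "tag (flip_step s) = Forward \<longleftrightarrow> tag s = Backward"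
  "tag (flip_step s) = Backward \<longleftrightarrow> tag s = Forward"
  "tag (flip_step s) = Bidirected \<longleftrightarrow> tag s = Bidirected"
  by (cases s rule: flip_step.cases; simp)+

definition rev_walk :: "'v walk \<Rightarrow> 'v walk" where
  "rev_walk w = rev (map flip_step w)"

lemma is_walk_rev_walk:
  assumes "sym (bidir_edges G)" and "is_walk G a b w"
  shows "is_walk G b a (rev_walk w)"
proof -
  have "step_in G (flip_step s)" if "step_in G s" for s
    using that assms(1) by (cases s rule: flip_step.cases) (auto dest: symD)
  moreover have "successively (\<lambda>s s'. tgt s = src s') (rev (map flip_step w))"
    if "successively (\<lambda>s s'. tgt s = src s') w"
    using that unfolding successively_rev successively_map flip_step_simps
    by (rule successively_mono) simp
  moreover have "hd (rev_walk w) = flip_step (last w)" "last (rev_walk w) = flip_step (hd w)"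
    if "w \<noteq> []"
    using that by (simp_all add: rev_walk_def hd_rev last_rev last_map hd_map)
  moreover have "rev_walk w \<noteq> []" if "w \<noteq> []"
    using that by (simp add: rev_walk_def)
  moreover have "set (rev_walk w) = flip_step ` set w"
    by (simp add: rev_walk_def)
  ultimately show ?thesis
    using assms(2) unfolding is_walk_iff by (auto simp: rev_walk_def[symmetric])
qed

lemma interior_src:
  assumes "successively (\<lambda>s s'. tgt s = src s') w"
  shows "src ` set (tl w) = tgt ` set (butlast w)"
  using assms by (induction w rule: induct_list012) auto

lemma interior_rev_walk:
  assumes "is_walk G a b w"
  shows "tgt ` set (butlast (rev_walk w)) = tgt ` set (butlast w)"
proof -
  have "butlast (rev_walk w) = rev (map flip_step (tl w))"
    by (simp add: rev_walk_def butlast_rev map_tl)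
  then have "tgt ` set (butlast (rev_walk w)) = src ` set (tl w)"
    by (simp add: image_image)
  moreover have "src ` set (tl w) = tgt ` set (butlast w)"
    using assms unfolding is_walk_iff by (intro interior_src) blast
  ultimately show ?thesis by (rule trans)
qed

section \<open>Walks avoiding a vertex set\<close>

text \<open>The defining condition of a directed marginal edge without membership of the endpoints
  in \<open>W\<close>: later arguments follow walks through vertices outside
  \<open>W\<close>.\<close>

definition directed_avoiding :: "'v mixed_graph \<Rightarrow> 'v set \<Rightarrow> 'v \<Rightarrow> 'v \<Rightarrow> bool" where
  "directed_avoiding G W a b \<longleftrightarrow> (\<exists>w. right_directed_walk G a b w \<and> non_endpoints w \<inter> W = {})"

definition trek_avoiding :: "'v mixed_graph \<Rightarrow> 'v set \<Rightarrow> 'v \<Rightarrow> 'v \<Rightarrow> bool" where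
  "trek_avoiding G W a b \<longleftrightarrow> (\<exists>w. is_trek G a b w \<and> non_endpoints w \<inter> W = {})"

lemma marginal_graph_edges [simp]:
  "(a, b) \<in> dir_edges (marginal_graph G W) \<longleftrightarrow> a \<in> W \<and> b \<in> W \<and> directed_avoiding G W a b"
  "(a, b) \<in> bidir_edges (marginal_graph G W) \<longleftrightarrow> a \<in> W \<and> b \<in> W \<and> trek_avoiding G W a b"
  by (auto simp: marginal_graph_def directed_avoiding_def trek_avoiding_def)

lemma non_endpoints_append_subset:
  "non_endpoints (w @ w') \<subseteq> insert (tgt (last w)) (non_endpoints w \<union> non_endpoints w')"
  unfolding non_endpoints_eq by (cases w rule: rev_cases) (auto simp: butlast_append split: if_splits)

lemma directed_avoiding_edge: "(a, b) \<in> dir_edges G \<Longrightarrow> directed_avoiding G W a b"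
  unfolding directed_avoiding_def
  by (intro exI[of _ "[(a, Forward, b)]"])
     (simp add: right_directed_walk_def is_walk_iff right_directed_def non_endpoints_eq)

lemma directed_avoiding_trans:
  assumes "directed_avoiding G W a b" "b \<notin> W" "directed_avoiding G W b c"
  shows "directed_avoiding G W a c"
proof -
  obtain w w' where w: "right_directed_walk G a b w" "non_endpoints w \<inter> W = {}"
    and w': "right_directed_walk G b c w'" "non_endpoints w' \<inter> W = {}"
    using assms unfolding directed_avoiding_def by blast
  have "right_directed_walk G a c (w @ w')"
    using w(1) w'(1) by (auto simp: right_directed_walk_def right_directed_def intro: is_walk_append)
  moreover have "tgt (last w) = b"
    using w(1) by (simp add: right_directed_walk_def is_walk_iff)
  then have "non_endpoints (w @ w') \<inter> W = {}"
    using non_endpoints_append_subset[of w w'] w(2) w'(2) assms(2) by blast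
  ultimately show ?thesis unfolding directed_avoiding_def by blast
qed

lemma directed_avoiding_trancl: "directed_avoiding G W a b \<Longrightarrow> (a, b) \<in> (dir_edges G)\<^sup>+"
  unfolding directed_avoiding_def using right_directed_trancl by metis

text \<open>Stop at the first vertex of \<open>W\<close> on the walk. In the induction from the
  start, the next vertex either lies in \<open>W\<close> and is taken, or its own connection is
  prolonged by the edge in front.\<close>

lemma trancl_first_hit:
  assumes "(v, m) \<in> (dir_edges G)\<^sup>+" and "m \<in> W"
  obtains m' where "m' \<in> W" "directed_avoiding G W v m'" "m' = m \<or> (m', m) \<in> (dir_edges G)\<^sup>+"
proof -
  from assms have "\<exists>m'\<in>W. directed_avoiding G W v m' \<and> (m' = m \<or> (m', m) \<in> (dir_edges G)\<^sup>+)"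
  proof (induction rule: converse_trancl_induct)
    case (base y)
    then show ?case using directed_avoiding_edge by metis
  next
    case (step y z)
    then show ?case
      using directed_avoiding_edge directed_avoiding_trans by metis
  qed
  with that show thesis by blast
qed

lemma trek_avoiding_edge: "(a, b) \<in> bidir_edges G \<Longrightarrow> trek_avoiding G W a b"
  unfolding trek_avoiding_def
  by (intro exI[of _ "[(a, Bidirected, b)]"])
     (auto simp: is_trek_def is_walk_iff non_endpoints_eq intro: exI[of _ "[]"])

lemma trek_avoiding_append:
  assumes "trek_avoiding G W a b" "b \<notin> W" "directed_avoiding G W b c"
  shows "trek_avoiding G W a c"
proof -
  obtain w w' where w: "is_trek G a b w" "non_endpoints w \<inter> W = {}"
    and w': "right_directed_walk G b c w'" "non_endpoints w' \<inter> W = {}"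
    using assms unfolding directed_avoiding_def trek_avoiding_def by blast
  obtain l m r where lmr: "w = l @ [m] @ r" "\<forall>s\<in>set l. tag s = Backward" "tag m = Bidirected"
      "\<forall>s\<in>set r. tag s = Forward"
    using w(1) unfolding is_trek_def by blast
  have "w @ w' = l @ [m] @ (r @ w')" "\<forall>s\<in>set (r @ w'). tag s = Forward"
    using lmr w'(1) by (auto simp: right_directed_walk_def right_directed_def)
  moreover have "is_walk G a c (w @ w')"
    using w(1) w'(1) by (auto simp: is_trek_def right_directed_walk_def intro: is_walk_append)
  ultimately have "is_trek G a c (w @ w')"
    using lmr unfolding is_trek_def by blast
  moreover have "tgt (last w) = b"
    using w(1) by (simp add: is_trek_def is_walk_iff)
  then have "non_endpoints (w @ w') \<inter> W = {}"
    using non_endpoints_append_subset[of w w'] w(2) w'(2) assms(2) by blast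
  ultimately show ?thesis unfolding trek_avoiding_def by blast
qed

lemma trek_avoiding_sym:
  assumes "sym (bidir_edges G)" "trek_avoiding G W a b"
  shows "trek_avoiding G W b a"
proof -
  obtain w where w: "is_trek G a b w" "non_endpoints w \<inter> W = {}"
    using assms unfolding trek_avoiding_def by blast
  obtain l m r where lmr: "w = l @ [m] @ r" "\<forall>s\<in>set l. tag s = Backward" "tag m = Bidirected"
      "\<forall>s\<in>set r. tag s = Forward"
    using w(1) unfolding is_trek_def by blast
  have walk: "is_walk G a b w" using w(1) by (simp add: is_trek_def)
  have "rev_walk w = rev_walk r @ [flip_step m] @ rev_walk l"
    using lmr(1) by (simp add: rev_walk_def)
  moreover have "\<forall>s\<in>set (rev_walk r). tag s = Backward" "\<forall>s\<in>set (rev_walk l). tag s = Forward"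
    using lmr by (auto simp: rev_walk_def)
  moreover have "tag (flip_step m) = Bidirected" using lmr by simp
  ultimately have "is_trek G b a (rev_walk w)"
    using is_walk_rev_walk[OF assms(1) walk] unfolding is_trek_def by blast
  moreover have "non_endpoints (rev_walk w) \<inter> W = {}"
    using w(2) interior_rev_walk[OF walk] by (simp add: non_endpoints_eq)
  ultimately show ?thesis unfolding trek_avoiding_def by blast
qed

section \<open>Separation in the marginal graph\<close>

locale regression_graph =
  fixes G :: "'v mixed_graph" and j k :: 'v and L :: "'v set"
  assumes sym_bidir: "sym (bidir_edges G)"
    and bidir_refl: "\<And>a. (a, a) \<in> bidir_edges G"
    and acyclic: "acyclic (dir_edges G)"
    and j_neq_k: "j \<noteq> k" and j_notin: "j \<notin> L" and k_notin: "k \<notin> L"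
begin

abbreviation "W \<equiv> {j, k} \<union> L"
abbreviation "Gt \<equiv> marginal_graph G W"
abbreviation "da \<equiv> directed_avoiding G W"
abbreviation "ta \<equiv> trek_avoiding G W"

lemmas ta_sym = trek_avoiding_sym[OF sym_bidir]

lemma ta_prepend: "ta b c \<Longrightarrow> b \<notin> W \<Longrightarrow> da b a \<Longrightarrow> ta a c"
  using ta_sym trek_avoiding_append by metis

text \<open>Canonicity enters here: the loop \<open>v <-> v\<close> turns a common source outside
  \<open>W\<close> into a trek, from \<open>a\<close> back to \<open>v\<close>, through the loop and
  on to \<open>b\<close>.\<close>

lemma da_ta: "v \<notin> W \<Longrightarrow> da v a \<Longrightarrow> da v b \<Longrightarrow> ta a b"
  using ta_prepend trek_avoiding_append trek_avoiding_edge[OF bidir_refl] by metis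

text \<open>Only the first edge may be directed: an edge between two later vertices needs arrowheads
  at both ends for them to be colliders. Repeated vertices are allowed here and are removed in
  \<open>reached_path\<close>.\<close>

inductive reached :: "'v \<Rightarrow> bool" where
  direct: "u \<in> L \<Longrightarrow> da j u \<or> ta j u \<Longrightarrow> reached u"
| bidir: "reached u \<Longrightarrow> v \<in> L \<Longrightarrow> ta u v \<Longrightarrow> reached v"

text \<open>A loop at \<open>k\<close> is excluded by acyclicity, so the first two clauses say that
  \<open>k\<close> has no child. An edge \<open>u -> k\<close> from a reached \<open>u\<close> may
  exist, since it makes \<open>u\<close> a non-collider in \<open>L\<close> and so blocks the
  path.\<close>

definition separated :: bool where
  "separated \<longleftrightarrow> \<not> da k j \<and> (\<forall>m\<in>L. \<not> da k m) \<and> \<not> ta j k \<and> (\<forall>u. reached u \<longrightarrow> \<not> ta u k)"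

lemma reached_in: "reached u \<Longrightarrow> u \<in> L"
  by (induction rule: reached.induct)

lemma reached_path:
  assumes "reached u"
  shows "\<exists>w. is_walk Gt j u w \<and> tag (hd w) \<noteq> Backward \<and> (\<forall>s\<in>set (tl w). tag s = Bidirected) \<and>
    tgt ` set w \<subseteq> L \<and> distinct (map tgt w)"
  using assms
proof (induction rule: reached.induct)
  case (direct u)
  then obtain t where "t \<noteq> Backward" "step_in Gt (j, t, u)"
    by (metis (no_types, lifting) Un_iff edge_type.distinct(1) edge_type.distinct(5) insertI1
        marginal_graph_edges step_in.simps(1,3))
  then show ?case
    using direct by (intro exI[of _ "[(j, t, u)]"]) (simp add: is_walk_iff)
next
  case (bidir u v)
  then obtain w where w: "is_walk Gt j u w" "tag (hd w) \<noteq> Backward"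
      "\<forall>s\<in>set (tl w). tag s = Bidirected" "tgt ` set w \<subseteq> L" "distinct (map tgt w)"
    by blast
  show ?case
  proof (cases "v \<in> tgt ` set w")
    case True
    \<comment> \<open>The walk already visits \<open>v\<close>; its initial segment up to
      \<open>v\<close> is kept.\<close>
    then obtain p s q where pq: "w = p @ s # q" "tgt s = v"
      by (metis (no_types, lifting) image_iff split_list)
    show ?thesis
      using w pq
      by (intro exI[of _ "p @ [s]"])
         (auto simp: is_walk_iff successively_append_iff successively_Cons hd_append tl_append
           split: if_splits list.splits)
  next
    case False
    let ?s = "(u, Bidirected, v)"
    have "step_in Gt ?s"
      using bidir reached_in by simp
    then have "is_walk Gt j v (w @ [?s])"
      using w(1) is_walk_append[of Gt j u w v "[?s]"] by (simp add: is_walk_Cons)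
    moreover have "w \<noteq> []" using w(1) by (simp add: is_walk_iff)
    ultimately show ?thesis
      using w False bidir.hyps
      by (intro exI[of _ "w @ [?s]"]) auto
  qed
qed

section \<open>From (a) and (b) to separation\<close>

lemma separatedI:
  assumes a: "\<And>w. is_path Gt j k w \<Longrightarrow> \<not> blocked L w \<Longrightarrow> w = [(j, Forward, k)]"
    and b: "\<And>m w. m \<in> L \<Longrightarrow> \<not> right_directed_walk Gt k m w"
  shows separated
  unfolding separated_def
proof (intro conjI allI impI ballI notI)
  assume "da k j"
  then show False
    using a[of "[(j, Backward, k)]"] j_neq_k
    by (simp add: is_path_def is_walk_iff walk_verts_def not_blocked_iff)
next
  fix m assume "m \<in> L" "da k m"
  then show False
    using b[of m "[(k, Forward, m)]"]
    by (simp add: right_directed_walk_def right_directed_def is_walk_iff)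
next
  assume "ta j k"
  then show False
    using a[of "[(j, Bidirected, k)]"] j_neq_k
    by (simp add: is_path_def is_walk_iff walk_verts_def not_blocked_iff)
next
  fix u assume u: "reached u" "ta u k"
  obtain w where w: "is_walk Gt j u w" "tag (hd w) \<noteq> Backward"
      "\<forall>s\<in>set (tl w). tag s = Bidirected" "tgt ` set w \<subseteq> L" "distinct (map tgt w)"
    using reached_path[OF u(1)] by blast
  let ?s = "(u, Bidirected, k)"
  have ne: "w \<noteq> []" using w(1) by (simp add: is_walk_iff)
  have "is_walk Gt j k (w @ [?s])"
    using w(1) u reached_in by (intro is_walk_append[of Gt j u]) (auto simp: is_walk_Cons)
  moreover have "distinct (walk_verts (w @ [?s]))"
    using ne w k_notin j_notin j_neq_k by (auto simp: walk_verts_def hd_append is_walk_iff)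
  moreover have "tag s \<noteq> Backward" if "s \<in> set w" for s
    using w(2,3) that by (cases w) auto
  \<comment> \<open>No step is backward and all but the first are bidirected, so every non-endpoint
    is a collider.\<close>
  then have "successively (\<lambda>s s'. collides s s' \<and> tgt s \<in> L) (w @ [?s])"
    using w(3,4) ne
  proof (induction w)
    case (Cons s w)
    have "collides s s'" if "tag s' = Bidirected" for s'
      using that Cons.prems(1)[of s] by (cases "tag s") (auto simp: collides_def)
    with Cons show ?case
      by (cases w) (auto simp: successively_Cons)
  qed simp
  then have "\<not> blocked L (w @ [?s])"
    unfolding not_blocked_iff by (rule successively_mono) auto
  ultimately show False
    using a[of "w @ [?s]"] ne by (simp add: is_path_def)
qed

section \<open>From separation to conditions 1--3\<close>

lemma separated_not_ancestor:
  assumes separated "m \<in> L"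
  shows "(k, m) \<notin> (dir_edges G)\<^sup>+"
proof
  assume km: "(k, m) \<in> (dir_edges G)\<^sup>+"
  \<comment> \<open>The first vertex of \<open>W\<close> on the walk would be a child of
    \<open>k\<close> in \<open>Gt\<close>; acyclicity rules out that it is \<open>k\<close>
    itself.\<close>
  then obtain m' where m': "m' \<in> W" "da k m'"
    using assms(2) trancl_first_hit[OF km, of W] by blast
  moreover have "m' \<noteq> k"
    using directed_avoiding_trancl[OF m'(2)] acyclic by (auto simp: acyclic_def)
  ultimately show False using assms(1) by (auto simp: separated_def)
qed

text \<open>If \<open>v\<close> is not in \<open>L\<close>, then \<open>u\<close> is the first vertex in \<open>W\<close> on a directed walk from \<open>v\<close> to \<open>L\<close>;
  that walk may run into \<open>j\<close>, and the walk under consideration is then restarted at \<open>j\<close>.\<close>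

lemma collider_source:
  assumes sep: separated
    and u0: "u0 = j \<and> (da j v \<or> ta j v) \<or> reached u0 \<and> ta u0 v"
    and v: "v \<in> L \<or> ancestor_of G v L" "v \<notin> {j, k}"
  shows "\<exists>u. (u = j \<or> reached u) \<and> (u = v \<or> v \<notin> W \<and> da v u)"
proof (cases "v \<in> L")
  case True
  then show ?thesis using u0 reached.intros by metis
next
  case False
  with v have vW: "v \<notin> W" by auto
  obtain n where n: "n \<in> L" "(v, n) \<in> (dir_edges G)\<^sup>+"
    using v False by (auto simp: ancestor_of_iff)
  then obtain m where m: "m \<in> W" "da v m" "m = n \<or> (m, n) \<in> (dir_edges G)\<^sup>+"
    using trancl_first_hit[of v n G W] by blast
  have "m \<noteq> k"
    using m(3) n(1) k_notin separated_not_ancestor[OF sep n(1)] by auto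
  \<comment> \<open>The connection from \<open>u0\<close> into \<open>v\<close> is prolonged along
    the directed walk from \<open>v\<close> to \<open>m\<close>.\<close>
  moreover have "reached m" if "m \<in> L"
    using u0 reached.intros that vW m(2) directed_avoiding_trans trek_avoiding_append by metis
  ultimately show ?thesis using m vW by blast
qed

text \<open>An invariant for initial segments, by induction on the last step. Either the segment is
  right-directed; or it ends with an arrowhead and a trek joins \<open>j\<close> or a reached vertex
  to the current vertex; or it ends with a tail and the current vertex has a directed connection to
  \<open>j\<close> or a reached vertex. At \<open>k\<close>, \<open>separated\<close> excludes the
  last two cases.\<close>

lemma separated_walk:
  assumes sep: separated
    and "w \<noteq> []" "src (hd w) = j" "\<forall>s\<in>set w. step_in G s" "successively (\<lambda>s s'. tgt s = src s') w"
    and "\<not> ancestrally_blocked G L w" "tgt ` set (butlast w) \<inter> {j, k} = {}"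
  shows "right_directed w \<and> da j (tgt (last w)) \<or>
    tag (last w) \<noteq> Backward \<and> (\<exists>u. (u = j \<or> reached u) \<and> ta u (tgt (last w))) \<or>
    tag (last w) = Backward \<and> (\<exists>u. (u = j \<or> reached u) \<and> da (tgt (last w)) u)"
  using assms(2-)
proof (induction w rule: rev_induct)
  case Nil
  then show ?case by simp
next
  case (snoc s w)
  obtain v t x where s: "s = (v, t, x)" by (cases s)
  have edge: "step_in G (v, t, x)" using snoc.prems s by simp
  show ?case
  proof (cases "w = []")
    case True
    with snoc.prems s have "v = j" by simp
    with True edge s show ?thesis
      by (cases t) (auto simp: right_directed_def intro: directed_avoiding_edge trek_avoiding_edge)
  next
    case False
    note prems = snoc.prems[unfolded not_ancestrally_blocked_iff]
    have last: "tgt (last w) = v"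
      using prems False s by (auto simp: successively_append_iff)
    have v: "v \<notin> {j, k}"
    proof -
      have "tgt (last w) \<in> tgt ` set (butlast (w @ [s]))" using False by simp
      then show ?thesis using prems(6) last by auto
    qed
    have joint: "if collides (last w) s then v \<in> L \<or> ancestor_of G v L else v \<notin> L"
      using prems False last by (auto simp: successively_append_iff)
    have "\<not> ancestrally_blocked G L w" "tgt ` set (butlast w) \<inter> {j, k} = {}"
      unfolding not_ancestrally_blocked_iff using prems False
      by (auto simp: successively_append_iff dest: in_set_butlastD)
    then have IH: "right_directed w \<and> da j v \<or>
      tag (last w) \<noteq> Backward \<and> (\<exists>u. (u = j \<or> reached u) \<and> ta u v) \<or>
      tag (last w) = Backward \<and> (\<exists>u. (u = j \<or> reached u) \<and> da v u)"
      using snoc.IH prems False last by (auto simp: successively_append_iff)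
    have not_back: "tag (last w) \<noteq> Backward" if "right_directed w"
      using that False by (auto simp: right_directed_def)
    \<comment> \<open>Covers every step with an arrowhead at \<open>v\<close>: a connection from
      \<open>v\<close> to \<open>u\<close> extends to a directed one from \<open>x\<close> to
      \<open>u\<close>, or to a trek between \<open>u\<close> and \<open>x\<close>.\<close>
    have out: "right_directed (w @ [s]) \<and> da j (tgt (last (w @ [s]))) \<or>
      tag (last (w @ [s])) \<noteq> Backward \<and> (\<exists>u. (u = j \<or> reached u) \<and> ta u (tgt (last (w @ [s])))) \<or>
      tag (last (w @ [s])) = Backward \<and> (\<exists>u. (u = j \<or> reached u) \<and> da (tgt (last (w @ [s]))) u)" if "(u = j \<or> reached u) \<and> (u = v \<or> v \<notin> W \<and> da v u)" "t \<noteq> Forward" for u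
    proof (cases t)
      case Backward
      with edge have "da x v" by (auto intro: directed_avoiding_edge)
      then have "da x u" using that directed_avoiding_trans by metis
      with that s Backward show ?thesis by auto
    next
      case Bidirected
      with edge have "ta v x" by (auto intro: trek_avoiding_edge)
      then have "ta u x" using that ta_prepend by metis
      with that s Bidirected show ?thesis by auto
    qed (use that in simp)
    show ?thesis
    proof (cases "collides (last w) s")
      case True
      then have t: "t \<noteq> Forward" "tag (last w) \<noteq> Backward" using s by (auto simp: collides_def)
      have "\<exists>u. (u = j \<or> reached u) \<and> (u = v \<or> v \<notin> W \<and> da v u)"
        using collider_source[OF sep _ _ v] IH True joint t by metis
      with out t show ?thesis by blast
    next
      case nc: False
      with joint v have vW: "v \<notin> W" by auto
      show ?thesis
      proof (cases t)
        case Forward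
        with edge have vx: "da v x" by (auto intro: directed_avoiding_edge)
        from IH show ?thesis
        proof (elim disjE)
          assume "right_directed w \<and> da j v"
          then have "right_directed (w @ [s]) \<and> da j x"
            using vx vW directed_avoiding_trans s Forward by (fastforce simp: right_directed_def)
          then show ?thesis using s by simp
        next
          assume "tag (last w) \<noteq> Backward \<and> (\<exists>u. (u = j \<or> reached u) \<and> ta u v)"
          then have "\<exists>u. (u = j \<or> reached u) \<and> ta u x"
            using vx vW trek_avoiding_append by metis
          then show ?thesis using s Forward by simp
        next
          \<comment> \<open>Both edges at \<open>v\<close> have their tail there, so
            \<open>v\<close> is a common source of \<open>u\<close> and \<open>x\<close>.\<close>
          assume "tag (last w) = Backward \<and> (\<exists>u. (u = j \<or> reached u) \<and> da v u)"
          then have "\<exists>u. (u = j \<or> reached u) \<and> ta u x"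
            using vx vW da_ta by metis
          then show ?thesis using s Forward by simp
        qed
      next
        case Backward
        \<comment> \<open>The leaving edge has an arrowhead at the non-collider \<open>v\<close>, so
          the entering edge has its tail there and the third case of the invariant applies. A
          bidirected leaving edge is treated in the same way.\<close>
        then have "tag (last w) = Backward"
          using nc s by (cases "tag (last w)") (auto simp: collides_def)
        then have "\<exists>u. (u = j \<or> reached u) \<and> (u = v \<or> v \<notin> W \<and> da v u)"
          using IH not_back vW by blast
        with out Backward show ?thesis by blast
      next
        case Bidirected
        then have "tag (last w) = Backward"
          using nc s by (cases "tag (last w)") (auto simp: collides_def)
        then have "\<exists>u. (u = j \<or> reached u) \<and> (u = v \<or> v \<notin> W \<and> da v u)"
          using IH not_back vW by blast
        with out Bidirected show ?thesis by blast
      qed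
    qed
  qed
qed

lemma separated_right_directed:
  assumes separated "is_path G j k w" "\<not> ancestrally_blocked G L w"
  shows "right_directed w"
proof -
  have w: "is_walk G j k w" "distinct (walk_verts w)" using assms by (auto simp: is_path_def)
  then have ne: "w \<noteq> []" by (simp add: is_walk_iff)
  then have "map tgt w = map tgt (butlast w) @ [tgt (last w)]"
    by (metis append_butlast_last_id list.simps(8,9) map_append)
  then have "tgt ` set (butlast w) \<inter> {j, k} = {}"
    using w by (auto simp: walk_verts_def is_walk_iff dest: in_set_butlastD)
  then have "right_directed w \<or> (\<exists>u. (u = j \<or> reached u) \<and> (ta u k \<or> da k u))"
    using separated_walk[OF assms(1) ne] w(1) assms(3) unfolding is_walk_iff by blast
  then show ?thesis
    using assms(1) reached_in unfolding separated_def by blast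
qed

lemma right_directed_walk_endpoint:
  assumes "right_directed_walk G a b w" "x \<in> tgt ` set (butlast w)"
  shows "x \<noteq> a" "x \<noteq> b"
proof -
  obtain w1 w2 where "right_directed_walk G a x w1" "right_directed_walk G x b w2"
    using right_directed_walk_split[OF assms] by metis
  then show "x \<noteq> a" "x \<noteq> b"
    using acyclic right_directed_trancl by (metis acyclic_def)+
qed

text \<open>Let \<open>m'\<close> be the first vertex of \<open>W\<close> on the way from
  \<open>l\<close> to \<open>m\<close>. It is not \<open>k\<close>, which has no descendant in
  \<open>L\<close>, nor \<open>j\<close>, which would close a cycle. So it lies in \<open>L\<close>
  and is reached through \<open>l\<close>, and the common source \<open>l\<close> gives a forbidden
  trek from \<open>m'\<close> to \<open>k\<close>.\<close>

lemma separated_no_ancestor_on_causal_path: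
  assumes sep: separated and l: "l \<notin> W"
    and w: "right_directed_walk G j k w" "l \<in> non_endpoints w" "\<not> blocked L w"
    and m: "m \<in> L" "(l, m) \<in> (dir_edges G)\<^sup>+"
  shows False
proof -
  have rd: "right_directed w" using w by (simp add: right_directed_walk_def)
  have int: "tgt ` set (butlast w) \<inter> W = {}"
    using w(3) right_directed_walk_endpoint[OF w(1)]
    unfolding right_directed_not_blocked_iff[OF rd] by auto
  obtain w1 w2 where w12: "w = w1 @ w2" "right_directed_walk G j l w1" "right_directed_walk G l k w2"
    using right_directed_walk_split[OF w(1)] w(2) unfolding non_endpoints_eq by metis
  have "w2 \<noteq> []" using w12 by (auto simp: right_directed_walk_def is_walk_iff)
  then have "butlast w = w1 @ butlast w2" using w12(1) by (simp add: butlast_append)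
  then have "set (butlast w1) \<subseteq> set (butlast w)" "set (butlast w2) \<subseteq> set (butlast w)"
    by (auto dest: in_set_butlastD)
  then have "non_endpoints w1 \<inter> W = {}" "non_endpoints w2 \<inter> W = {}"
    using int unfolding non_endpoints_eq by (meson disjoint_iff image_mono subsetD)+
  then have "da j l" "da l k"
    using w12(2,3) unfolding directed_avoiding_def by blast+
  obtain m' where m': "m' \<in> W" "da l m'" "m' = m \<or> (m', m) \<in> (dir_edges G)\<^sup>+"
    using trancl_first_hit[OF m(2), of W] m(1) by blast
  have "m' \<noteq> k"
    using m' m(1) k_notin separated_not_ancestor[OF sep m(1)] by auto
  moreover have "m' \<noteq> j"
    using directed_avoiding_trans[OF \<open>da j l\<close> l m'(2)] acyclic directed_avoiding_trancl
    by (metis acyclic_def)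
  ultimately have "m' \<in> L" using m' by auto
  then have "reached m'"
    using directed_avoiding_trans[OF \<open>da j l\<close> l m'(2)] reached.direct by blast
  then show False
    using sep da_ta[OF l m'(2) \<open>da l k\<close>] by (auto simp: separated_def)
qed

section \<open>From conditions 1--3 back to (a) and (b)\<close>

lemma ancestor_of_edge: "(a, b) \<in> dir_edges G \<Longrightarrow> b \<in> L \<or> ancestor_of G b L \<Longrightarrow> ancestor_of G a L"
  unfolding ancestor_of_iff by (meson r_into_trancl' trancl_into_trancl2)

text \<open>The initial run of forward steps must end at a collider, which is in \<open>L\<close> or
  an ancestor of \<open>L\<close>; following the run back makes its start an ancestor.\<close>

lemma leaving_collider:
  assumes "\<forall>s\<in>set w. step_in G s" "successively (\<lambda>s s'. tgt s = src s') w"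
    and "\<not> ancestrally_blocked G L w" "w \<noteq> []" "tag (hd w) = Forward" "\<not> right_directed w"
  shows "ancestor_of G (src (hd w)) L"
  using assms unfolding not_ancestrally_blocked_iff
proof (induction w rule: induct_list012)
  case (2 s)
  then show ?case by (simp add: right_directed_def)
next
  case (3 s s' w)
  have "(src s, tgt s) \<in> dir_edges G"
    using 3 by (cases s rule: flip_step.cases) auto
  moreover have "tgt s \<in> L \<or> ancestor_of G (tgt s) L"
  proof (cases "tag s' = Forward")
    case True
    with 3 show ?thesis by (auto simp: right_directed_def)
  next
    case False
    then have "collides s s'" using 3 by (cases "tag s'") (auto simp: collides_def)
    with 3 show ?thesis by auto
  qed
  ultimately show ?case using ancestor_of_edge by simp
qed simp

definition connecting :: "'v walk \<Rightarrow> bool" where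
  "connecting w \<longleftrightarrow> is_walk G j k w \<and> \<not> ancestrally_blocked G L w \<and>
     (\<not> right_directed w \<or> (\<exists>x\<in>non_endpoints w. ancestor_of G x L))"

text \<open>Cutting out a loop keeps the walk connecting: if a new collider arises, or if the shortened
  walk is right-directed, then the removed loop makes the cutting point an ancestor of \<open>L\<close>.\<close>

lemma connecting_path:
  assumes "connecting w" "non_endpoints w \<inter> {j, k} = {}"
  shows "\<exists>w. is_path G j k w \<and> connecting w"
  using assms
proof (induction w rule: length_induct)
  case (1 w)
  show ?case
  proof (cases "distinct (walk_verts w)")
    case True
    with 1 show ?thesis by (auto simp: is_path_def connecting_def)
  next
    case False
    have walk: "is_walk G j k w" using 1 by (simp add: connecting_def)
    then have "w \<noteq> []" by (simp add: is_walk_iff)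
    have ends: "tgt ` set (butlast w) \<inter> {j, k} = {}" using 1 by (simp add: non_endpoints_eq)
    have "set w = insert (last w) (set (butlast w))"
      using \<open>w \<noteq> []\<close> by (metis append_butlast_last_id list.simps(15) rotate1.simps(2) set_rotate1)
    then have set_w: "tgt ` set w = insert k (tgt ` set (butlast w))"
      using walk by (simp add: is_walk_iff)
    have "j \<notin> tgt ` set w" using set_w ends j_neq_k by auto
    \<comment> \<open>As \<open>j\<close> occurs only at the start, the repeated vertex occurs twice
      among the targets.\<close>
    then have "\<not> distinct (map tgt w)"
      using False walk by (auto simp: walk_verts_def is_walk_iff)
    then obtain xs ys zs c where "map tgt w = xs @ [c] @ ys @ [c] @ zs"
      using not_distinct_decomp by blast
    then obtain p s1 q s2 w3 where dec: "w = p @ [s1] @ q @ [s2] @ w3" "tgt s1 = c" "tgt s2 = c"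
      by (auto simp: map_eq_append_conv map_eq_Cons_conv append_eq_map_conv Cons_eq_map_conv)
    define w1 w2 where "w1 = p @ [s1]" and "w2 = q @ [s2]"
    have w: "w = w1 @ w2 @ w3" "w1 \<noteq> []" "w2 \<noteq> []" "tgt (last w1) = c" "tgt (last w2) = c"
      using dec by (auto simp: w1_def w2_def)
    have "c \<in> tgt ` set (butlast w)"
      using w dec by (auto simp: butlast_append)
    then have "c \<noteq> k" using ends by auto
    then have "w3 \<noteq> []" using walk w by (auto simp: is_walk_iff)
    have walk': "\<forall>s\<in>set w. step_in G s" "successively (\<lambda>s s'. tgt s = src s') w"
      "successively (\<lambda>s s'. if collides s s' then tgt s \<in> L \<or> ancestor_of G (tgt s) L else tgt s \<notin> L) w"
      using walk 1(2) unfolding connecting_def is_walk_iff not_ancestrally_blocked_iff by blast+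
    have src: "src (hd w2) = c" "src (hd w3) = c"
      using walk'(2) w \<open>w3 \<noteq> []\<close> by (auto simp: successively_append_iff)
    have j12: "if collides (last w1) (hd w2) then c \<in> L \<or> ancestor_of G c L else c \<notin> L"
      and j23: "if collides (last w2) (hd w3) then c \<in> L \<or> ancestor_of G c L else c \<notin> L"
      using walk'(3) w \<open>w3 \<noteq> []\<close> by (auto simp: successively_append_iff)
    have loop: "ancestor_of G c L" if "tag (hd w2) = Forward" "\<not> right_directed w2"
      using leaving_collider[of w2] walk' w that src
      by (auto simp: successively_append_iff not_ancestrally_blocked_iff)
    \<comment> \<open>If both ends of the loop have tails at \<open>c\<close>, the loop contains a
      collider descending from \<open>c\<close>. Otherwise an arrowhead of the loop at
      \<open>c\<close> makes one of the two old joints a collider.\<close>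
    have "c \<in> L \<or> ancestor_of G c L" if "collides (last w1) (hd w3)"
    proof (cases "tag (hd w2) = Forward \<and> tag (last w2) = Backward")
      case True
      then have "\<not> right_directed w2"
        using w(3) by (metis edge_type.distinct(1) last_in_set right_directed_def)
      with True loop show ?thesis by blast
    next
      case False
      then have "collides (last w1) (hd w2) \<or> collides (last w2) (hd w3)"
        using that by (cases "tag (hd w2)"; cases "tag (last w2)") (auto simp: collides_def)
      then show ?thesis using j12 j23 by auto
    qed
    \<comment> \<open>If both old joints were colliders, the new one would be too; so one of them is
      a non-collider, which keeps \<open>c\<close> out of \<open>L\<close>.\<close>
    moreover have "c \<notin> L" if "\<not> collides (last w1) (hd w3)"
    proof -
      have "\<not> collides (last w1) (hd w2) \<or> \<not> collides (last w2) (hd w3)"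
        using that by (auto simp: collides_def)
      then show ?thesis using j12 j23 by auto
    qed
    ultimately have "\<not> ancestrally_blocked G L (w1 @ w3)"
      using walk'(3) w \<open>w3 \<noteq> []\<close> unfolding not_ancestrally_blocked_iff
      by (auto simp: successively_append_iff)
    moreover have "is_walk G j k (w1 @ w3)"
      using walk w \<open>w3 \<noteq> []\<close> src by (auto simp: is_walk_iff successively_append_iff hd_append)
    \<comment> \<open>The witness needed for \<open>connecting\<close> is \<open>c\<close>. By
      acyclicity the loop is not right-directed, so either it starts forward and \<open>loop\<close>
      applies, or the first old joint is a collider outside \<open>L\<close>.\<close>
    moreover have "ancestor_of G c L" if rd: "right_directed (w1 @ w3)"
    proof -
      have tags: "tag (last w1) = Forward" "tag (hd w3) = Forward"
        using rd w(2) \<open>w3 \<noteq> []\<close> by (auto simp: right_directed_def)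
      then have "c \<notin> L" using j23 by (auto simp: collides_def)
      have "\<not> right_directed w2"
      proof
        assume "right_directed w2"
        then have "right_directed_walk G c c w2"
          using walk' w src by (auto simp: right_directed_walk_def is_walk_iff successively_append_iff)
        then show False
          using acyclic right_directed_trancl by (metis acyclic_def)
      qed
      moreover have "ancestor_of G c L" if "tag (hd w2) \<noteq> Forward"
      proof -
        have "collides (last w1) (hd w2)"
          using that tags by (cases "tag (hd w2)") (auto simp: collides_def)
        then show ?thesis using j12 \<open>c \<notin> L\<close> by auto
      qed
      ultimately show ?thesis using loop by blast
    qed
    moreover have "c \<in> non_endpoints (w1 @ w3)"
      using \<open>w3 \<noteq> []\<close> w(2,4) by (force simp: non_endpoints_eq butlast_append)
    ultimately have "connecting (w1 @ w3)"
      unfolding connecting_def by blast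
    moreover have "non_endpoints (w1 @ w3) \<inter> {j, k} = {}"
      using ends w \<open>w3 \<noteq> []\<close> by (auto simp: non_endpoints_eq butlast_append)
    moreover have "length (w1 @ w3) < length w" using w by simp
    ultimately show ?thesis using 1(1) by blast
  qed
qed

lemma no_colliders_not_ancestrally_blocked:
  assumes "successively (\<lambda>s s'. \<not> collides s s') w" "non_endpoints w \<inter> W = {}"
  shows "\<not> ancestrally_blocked G L w"
proof -
  have "successively (\<lambda>s s'. tgt s \<in> - L) w"
    using assms(2) unfolding successively_tgt_iff non_endpoints_eq by auto
  then have "successively (\<lambda>s s'. \<not> collides s s' \<and> tgt s \<notin> L) w"
    using assms(1) by (auto simp: successively_conv_nth)
  then show ?thesis
    unfolding not_ancestrally_blocked_iff by (rule successively_mono) auto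
qed

lemma successively_not_collides:
  "(\<forall>s\<in>set w. tag s = Backward) \<or> (\<forall>s\<in>set w. tag s = Forward) \<Longrightarrow> successively (\<lambda>s s'. \<not> collides s s') w"
  by (induction w) (auto simp: successively_Cons collides_def)

text \<open>The walk underlying a marginal edge has no colliders. The two equivalences say that it
  keeps the tails and arrowheads of the edge at both ends, so that colliders at joints survive the
  expansion.\<close>

lemma expand_step:
  assumes "step_in Gt s"
  shows "\<exists>w. is_walk G (src s) (tgt s) w \<and> \<not> ancestrally_blocked G L w \<and> non_endpoints w \<inter> W = {} \<and>
    (tag (hd w) = Forward \<longleftrightarrow> tag s = Forward) \<and> (tag (last w) = Backward \<longleftrightarrow> tag s = Backward) \<and>
    (right_directed w \<longrightarrow> tag s = Forward)"
proof -
  obtain a t b where s: "s = (a, t, b)" by (cases s)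
  show ?thesis
  proof (cases t)
    case Forward
    with s assms obtain w where w: "right_directed_walk G a b w" "non_endpoints w \<inter> W = {}"
      by (auto simp: directed_avoiding_def)
    then have "w \<noteq> []" "\<forall>s\<in>set w. tag s = Forward"
      by (auto simp: right_directed_walk_def right_directed_def is_walk_iff)
    then have "\<not> ancestrally_blocked G L w" "tag (hd w) = Forward" "tag (last w) = Forward"
      using w no_colliders_not_ancestrally_blocked successively_not_collides by auto
    with w s Forward show ?thesis
      by (intro exI[of _ w]) (auto simp: right_directed_walk_def)
  next
    case Backward
    with s assms obtain w where w: "right_directed_walk G b a w" "non_endpoints w \<inter> W = {}"
      by (auto simp: directed_avoiding_def)
    then have "w \<noteq> []" "\<forall>s\<in>set w. tag s = Forward"
      by (auto simp: right_directed_walk_def right_directed_def is_walk_iff)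
    then have r: "rev_walk w \<noteq> []" "\<forall>s\<in>set (rev_walk w). tag s = Backward"
      by (auto simp: rev_walk_def)
    have "non_endpoints (rev_walk w) \<inter> W = {}"
      using w interior_rev_walk unfolding right_directed_walk_def non_endpoints_eq by metis
    moreover have "tag (hd (rev_walk w)) = Backward" "tag (last (rev_walk w)) = Backward"
      "\<not> right_directed (rev_walk w)"
      using r by (auto simp: right_directed_def simp del: split_paired_Ex dest: hd_in_set)
    moreover have "is_walk G a b (rev_walk w)"
      using w is_walk_rev_walk[OF sym_bidir] by (simp add: right_directed_walk_def)
    ultimately show ?thesis
      using s Backward no_colliders_not_ancestrally_blocked successively_not_collides r(2)
      by (intro exI[of _ "rev_walk w"]) auto
  next
    case Bidirected
    with s assms obtain w where w: "is_trek G a b w" "non_endpoints w \<inter> W = {}"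
      by (auto simp: trek_avoiding_def)
    obtain l m r where lmr: "w = l @ [m] @ r" "\<forall>s\<in>set l. tag s = Backward" "tag m = Bidirected"
        "\<forall>s\<in>set r. tag s = Forward"
      using w(1) unfolding is_trek_def by blast
    have "successively (\<lambda>s s'. \<not> collides s s') w"
      using lmr successively_not_collides[of l] successively_not_collides[of r]
      by (auto simp: successively_append_iff successively_Cons collides_def)
    moreover have "tag (hd w) \<noteq> Forward" using lmr by (cases l) auto
    moreover have "tag (last w) \<noteq> Backward" using lmr by (cases r rule: rev_cases) auto
    moreover have "\<not> right_directed w" using lmr by (auto simp: right_directed_def)
    ultimately show ?thesis
      using s w Bidirected no_colliders_not_ancestrally_blocked
      by (intro exI[of _ w]) (auto simp: is_trek_def)
  qed
qed

text \<open>The expanded edges are glued at vertices of \<open>L\<close>, and the preserved end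
  marks make each joint a collider, so nothing becomes blocked. The joints lie in \<open>W\<close>,
  hence only \<open>j\<close> and \<open>k\<close> are still avoided.\<close>

lemma expand_walk:
  assumes "is_walk Gt a b w" "successively (\<lambda>s s'. collides s s' \<and> tgt s \<in> L) w"
  shows "\<exists>w'. is_walk G a b w' \<and> \<not> ancestrally_blocked G L w' \<and> non_endpoints w' \<inter> {j, k} = {} \<and>
    (tag (hd w') = Forward \<longleftrightarrow> tag (hd w) = Forward) \<and> (right_directed w' \<longrightarrow> right_directed w)"
  using assms
proof (induction w arbitrary: a)
  case Nil
  then show ?case by (simp add: is_walk_iff)
next
  case (Cons s w)
  have s: "step_in Gt s" "src s = a" using Cons.prems by (auto simp: is_walk_iff)
  obtain v where v: "is_walk G a (tgt s) v" "\<not> ancestrally_blocked G L v" "non_endpoints v \<inter> W = {}"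
    "tag (hd v) = Forward \<longleftrightarrow> tag s = Forward" "tag (last v) = Backward \<longleftrightarrow> tag s = Backward"
    "right_directed v \<longrightarrow> tag s = Forward"
    using expand_step[OF s(1)] s(2) by blast
  show ?case
  proof (cases "w = []")
    case True
    with Cons.prems have "tgt s = b" by (simp add: is_walk_iff)
    with v True show ?thesis by (intro exI[of _ v]) (auto simp: right_directed_def)
  next
    case False
    with Cons.prems have "is_walk Gt (tgt s) b w" "successively (\<lambda>s s'. collides s s' \<and> tgt s \<in> L) w"
      and joint: "collides s (hd w)" "tgt s \<in> L"
      by (auto simp: is_walk_Cons successively_Cons)
    with Cons.IH obtain w' where w': "is_walk G (tgt s) b w'" "\<not> ancestrally_blocked G L w'"
      "non_endpoints w' \<inter> {j, k} = {}" "tag (hd w') = Forward \<longleftrightarrow> tag (hd w) = Forward"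
      "right_directed w' \<longrightarrow> right_directed w"
      by blast
    have ne: "v \<noteq> []" "w' \<noteq> []" "tgt (last v) = tgt s"
      using v(1) w'(1) by (auto simp: is_walk_iff)
    have "collides (last v) (hd w')"
      using joint v(5) w'(4) by (cases "tag (last v)"; cases "tag (hd w')") (auto simp: collides_def)
    then have "\<not> ancestrally_blocked G L (v @ w')"
      using v(2) w'(2) ne joint unfolding not_ancestrally_blocked_iff
      by (auto simp: successively_append_iff)
    moreover have "is_walk G a b (v @ w')"
      using v(1) w'(1) by (rule is_walk_append)
    moreover have "non_endpoints (v @ w') \<inter> {j, k} = {}"
      using non_endpoints_append_subset[of v w'] v(3) w'(3) joint(2) ne j_notin k_notin by auto
    moreover have "right_directed (v @ w') \<longrightarrow> right_directed (s # w)"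
      using v(6) w'(5) by (auto simp: right_directed_def)
    moreover have "tag (hd (v @ w')) = Forward \<longleftrightarrow> tag (hd (s # w)) = Forward"
      using ne v(4) by simp
    ultimately show ?thesis by blast
  qed
qed

text \<open>Non-endpoints of a marginal path from \<open>j\<close> to \<open>k\<close> lie in
  \<open>L\<close>, so on an unblocked one they are all colliders, and a right-directed one is a
  single edge. Any other expands to a connecting walk, hence yields a connecting path, which
  contradicts \<open>c1\<close> or \<open>c3\<close>.\<close>

lemma unblocked_marginal_path:
  assumes c1: "\<And>w. is_path G j k w \<Longrightarrow> \<not> ancestrally_blocked G L w \<Longrightarrow> right_directed w"
    and c3: "\<And>l w m. l \<notin> W \<Longrightarrow> right_directed_walk G j k w \<Longrightarrow> l \<in> non_endpoints w \<Longrightarrow>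
       \<not> blocked L w \<Longrightarrow> m \<in> L \<Longrightarrow> (l, m) \<notin> (dir_edges G)\<^sup>+"
    and w: "is_path Gt j k w" "\<not> blocked L w"
  shows "w = [(j, Forward, k)]"
proof (rule ccontr)
  assume neq: "w \<noteq> [(j, Forward, k)]"
  have walk: "is_walk Gt j k w" and dist: "distinct (walk_verts w)"
    using w by (auto simp: is_path_def)
  have ne: "w \<noteq> []" using walk by (simp add: is_walk_iff)
  have edges: "\<forall>s\<in>set w. tgt s \<in> W"
  proof
    fix s assume "s \<in> set w"
    then have "step_in Gt s" using walk by (auto simp: is_walk_iff)
    then show "tgt s \<in> W" by (cases s rule: flip_step.cases) auto
  qed
  have "map tgt w = map tgt (butlast w) @ [tgt (last w)]"
    using ne by (metis append_butlast_last_id list.simps(8,9) map_append)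
  then have "tgt ` set (butlast w) \<inter> {j, k} = {}"
    using walk dist by (auto simp: walk_verts_def is_walk_iff dest: in_set_butlastD)
  with edges have "tgt ` set (butlast w) \<subseteq> L"
    by (auto dest: in_set_butlastD)
  then have "successively (\<lambda>s s'. tgt s \<in> L) w" unfolding successively_tgt_iff .
  then have coll: "successively (\<lambda>s s'. collides s s' \<and> tgt s \<in> L) w"
    using w(2) unfolding not_blocked_iff by (auto simp: successively_conv_nth)
  obtain w' where w': "is_walk G j k w'" "\<not> ancestrally_blocked G L w'"
    "non_endpoints w' \<inter> {j, k} = {}" "right_directed w' \<longrightarrow> right_directed w"
    using expand_walk[OF walk coll] by blast
  have "\<not> right_directed w"
  proof
    assume rd: "right_directed w"
    obtain s v where sv: "w = s # v" using ne by (cases w) auto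
    with rd coll have "v = []"
      by (cases v) (auto simp: right_directed_def collides_def)
    with sv rd walk have "w = [(j, Forward, k)]"
      by (cases s) (simp add: right_directed_def is_walk_iff)
    with neq show False by simp
  qed
  with w' have "connecting w'" by (auto simp: connecting_def)
  then obtain p where p: "is_path G j k p" "connecting p"
    using connecting_path w'(3) by blast
  then have rd: "right_directed p" using c1 by (auto simp: connecting_def)
  then obtain x where x: "x \<in> non_endpoints p" "ancestor_of G x L"
    using p by (auto simp: connecting_def)
  have pw: "right_directed_walk G j k p"
    using p rd by (simp add: is_path_def right_directed_walk_def)
  have L: "tgt ` set (butlast p) \<inter> L = {}"
    using p(2) right_directed_not_ancestrally_blocked_iff[OF rd] by (auto simp: connecting_def)
  then have "x \<notin> W"
    using x(1) right_directed_walk_endpoint[OF pw] by (auto simp: non_endpoints_eq)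
  moreover have "\<not> blocked L p" using L right_directed_not_blocked_iff[OF rd] by blast
  ultimately show False
    using c3[OF _ pw x(1)] x(2) by (auto simp: ancestor_of_iff)
qed

lemma trancl_marginal: "(a, b) \<in> (dir_edges Gt)\<^sup>+ \<Longrightarrow> (a, b) \<in> (dir_edges G)\<^sup>+"
proof (induction rule: trancl_induct)
  case (base y)
  then show ?case by (auto intro: directed_avoiding_trancl)
next
  case (step y z)
  then have "(y, z) \<in> (dir_edges G)\<^sup>+" by (auto intro: directed_avoiding_trancl)
  with step.IH show ?case by (rule trancl_trans)
qed

end

section \<open>Gaussian regression\<close>

text \<open>Gram-Schmidt, one vector at a time: \<open>e\<close> is \<open>h c\<close> with its part
  along \<open>C\<close> removed, and subtracting a multiple of \<open>e\<close> from the residual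
  \<open>y\<close> keeps orthogonality to the old vectors.\<close>

lemma projection_coefficients:
  fixes f :: "'a::real_vector \<Rightarrow> 'a \<Rightarrow> real"
  assumes f: "bilinear f" and sym: "\<And>x y. f x y = f y x" and def: "\<And>x. f x x = 0 \<Longrightarrow> x = 0"
    and "finite C"
  shows "\<exists>a. \<forall>c\<in>C. f (x - (\<Sum>b\<in>C. a b *\<^sub>R h b)) (h c) = 0"
  using \<open>finite C\<close>
proof (induction C arbitrary: x)
  case empty
  then show ?case by simp
next
  case (insert c C)
  obtain a where a: "\<forall>b\<in>C. f (x - (\<Sum>b\<in>C. a b *\<^sub>R h b)) (h b) = 0"
    using insert.IH by blast
  obtain d where d: "\<forall>b\<in>C. f (h c - (\<Sum>b\<in>C. d b *\<^sub>R h b)) (h b) = 0"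
    using insert.IH by blast
  define y where "y = x - (\<Sum>b\<in>C. a b *\<^sub>R h b)"
  define e where "e = h c - (\<Sum>b\<in>C. d b *\<^sub>R h b)"
  \<comment> \<open>For \<open>e = 0\<close> division by zero gives \<open>t = 0\<close>, and
    orthogonality to \<open>e\<close> is trivial.\<close>
  define t where "t = f y e / f e e"
  define a' where "a' b = (if b = c then t else a b - t * d b)" for b
  have lin: "linear (f z)" for z
    using f by (simp add: bilinear_def)
  have "(\<Sum>b\<in>insert c C. a' b *\<^sub>R h b) = t *\<^sub>R h c + (\<Sum>b\<in>C. (a b - t * d b) *\<^sub>R h b)"
    using insert.hyps by (auto simp: a'_def intro!: sum.cong)
  also have "\<dots> = (x - y) + t *\<^sub>R e"
    by (simp add: y_def e_def scaleR_diff_left sum_subtractf scaleR_diff_right scaleR_sum_right)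
  finally have *: "x - (\<Sum>b\<in>insert c C. a' b *\<^sub>R h b) = y - t *\<^sub>R e" by simp
  have C: "f (y - t *\<^sub>R e) (h b) = 0" if "b \<in> C" for b
    using that a d by (simp add: bilinear_lsub[OF f] bilinear_lmul[OF f] y_def[symmetric] e_def[symmetric])
  have "f (y - t *\<^sub>R e) e = 0"
    using def[of e] by (cases "e = 0")
      (auto simp: bilinear_lsub[OF f] bilinear_lmul[OF f] t_def bilinear_rzero[OF f])
  moreover have "h c = e + (\<Sum>b\<in>C. d b *\<^sub>R h b)" by (simp add: e_def)
  ultimately have "f (y - t *\<^sub>R e) (h c) = 0"
    using C by (simp add: linear_add[OF lin] linear_sum[OF lin] linear_cmul[OF lin])
  with C * show ?case by (intro exI[of _ a']) auto
qed

lemma bilinear_inner_matrix: "bilinear (\<lambda>x y. x \<bullet> ((A::real^'n^'m) *v y))"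
  by (auto simp: bilinear_def inner_add_left inner_add_right matrix_vector_right_distrib
      matrix_vector_mult_scaleR intro!: linearI)

lemma centered_normal_second_moment:
  assumes "prob_space M" and E: "centered_normal M E A"
  shows "(\<integral>\<omega>. (e \<bullet> E \<omega> - c)\<^sup>2 \<partial>M) = e \<bullet> (A *v e) + c\<^sup>2"
proof -
  interpret prob_space M by fact
  have meas [measurable]: "E \<in> borel_measurable M" using E by (simp add: centered_normal_def)
  consider "e \<bullet> (A *v e) = 0" "AE \<omega> in M. e \<bullet> E \<omega> = 0"
    | "e \<bullet> (A *v e) > 0" "distributed M lborel (\<lambda>\<omega>. e \<bullet> E \<omega>) (normal_density 0 (sqrt (e \<bullet> (A *v e))))"
    using E by (auto simp: centered_normal_def)
  then show ?thesis
  proof cases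
    case 1
    have "(\<integral>\<omega>. (e \<bullet> E \<omega> - c)\<^sup>2 \<partial>M) = (\<integral>\<omega>. c\<^sup>2 \<partial>M)"
      by (rule integral_cong_AE) (use 1(2) in auto)
    then show ?thesis using 1(1) by (simp add: prob_space)
  next
    case 2
    define s where "s = sqrt (e \<bullet> (A *v e))"
    have s: "s > 0" "s\<^sup>2 = e \<bullet> (A *v e)" using 2(1) by (auto simp: s_def)
    have D: "distributed M lborel (\<lambda>\<omega>. e \<bullet> E \<omega>) (normal_density 0 s)"
      using 2(2) by (simp add: s_def)
    let ?Z = "\<lambda>\<omega>. e \<bullet> E \<omega>"
    have mean: "expectation ?Z = 0" by (rule normal_distributed_expectation[OF s(1) D])
    have var: "expectation (\<lambda>\<omega>. (?Z \<omega>)\<^sup>2) = s\<^sup>2"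
      using normal_distributed_variance[OF s(1) D] mean by simp
    \<comment> \<open>All moments of a normal variable exist, so the expectation of the expanded
      square may be split.\<close>
    have "integrable lborel (\<lambda>x. normal_density 0 s x * (x - 0) ^ n)" for n
      by (rule integrable_normal_moment[OF s(1)])
    then have int: "integrable M (\<lambda>\<omega>. ?Z \<omega> ^ n)" for n
      using distributed_integrable[OF D, of "\<lambda>x. x ^ n"] by simp
    have "(\<integral>\<omega>. (?Z \<omega> - c)\<^sup>2 \<partial>M) = (\<integral>\<omega>. (?Z \<omega>)\<^sup>2 + (-2 * c) * ?Z \<omega> + c\<^sup>2 \<partial>M)"
      by (simp add: power2_eq_square algebra_simps)
    also have "\<dots> = s\<^sup>2 + (-2 * c) * 0 + c\<^sup>2"
      using int[of 1] int[of 2] mean var by (simp add: prob_space)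
    finally show ?thesis using s(2) by simp
  qed
qed

text \<open>The normal equations \<open>orth\<close> identify the minimiser: the risk is
  \<open>q (r b)\<close> plus the squared intercept, where \<open>q\<close> is the variance of a
  linear form in the noise. Definiteness of \<open>A\<close> and independence of the
  \<open>y v\<close> make the coefficient of \<open>j\<close> unique, so the definite description
  denotes it.\<close>

lemma regression_coeff_eqI:
  fixes A :: "real^'n^'n" and y :: "'v::finite \<Rightarrow> real^'n"
  assumes M: "prob_space M" and E: "centered_normal M E A" and pd: "positive_definite A"
    and X: "X \<in> borel_measurable M" "\<And>\<omega> v. \<omega> \<in> space M \<Longrightarrow> X \<omega> $ v = y v \<bullet> E \<omega>"
    and indep: "\<And>d. (\<Sum>v\<in>UNIV. d v *\<^sub>R y v) = 0 \<Longrightarrow> \<forall>v. d v = 0"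
    and orth: "\<And>s. s \<in> insert j L \<Longrightarrow> (y k - (\<Sum>t\<in>insert j L. b t *\<^sub>R y t)) \<bullet> (A *v y s) = 0"
  shows "regression_coeff (distr M borel X) k j L = b j"
proof -
  define q where "q e = e \<bullet> (A *v e)" for e
  define S where "S = insert j L"
  define r where "r b = y k - (\<Sum>s\<in>S. b s *\<^sub>R y s)" for b
  note bil = bilinear_inner_matrix[of A]
  have sym: "x \<bullet> (A *v z) = z \<bullet> (A *v x)" for x z
    using pd by (metis dot_lmul_matrix inner_commute positive_definite_def transpose_matrix_vector)
  have q_pos: "q e \<ge> 0" and q_zero: "q e = 0 \<Longrightarrow> e = 0" for e
    using pd unfolding positive_definite_def q_def
    by (metis inner_zero_left less_eq_real_def, metis less_irrefl)
  have risk: "(\<integral>x. (x $ k - (c + (\<Sum>s\<in>S. b s * x $ s)))\<^sup>2 \<partial>distr M borel X) = q (r b) + c\<^sup>2" for c b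
  proof -
    have "(\<integral>x. (x $ k - (c + (\<Sum>s\<in>S. b s * x $ s)))\<^sup>2 \<partial>distr M borel X) =
        (\<integral>\<omega>. (X \<omega> $ k - (c + (\<Sum>s\<in>S. b s * X \<omega> $ s)))\<^sup>2 \<partial>M)"
      by (intro integral_distr X(1) borel_measurable_continuous_onI continuous_intros)
    also have "\<dots> = (\<integral>\<omega>. (r b \<bullet> E \<omega> - c)\<^sup>2 \<partial>M)"
      by (intro Bochner_Integration.integral_cong)
         (auto simp: X(2) r_def inner_diff_left inner_sum_left algebra_simps)
    finally show ?thesis
      using centered_normal_second_moment[OF M E] by (simp add: q_def)
  qed
  \<comment> \<open>Pythagoras: the two residuals differ by a combination of the regressors, to
    which \<open>r b\<close> is orthogonal.\<close>
  have split: "q (r b') = q (r b) + q (\<Sum>s\<in>S. (b s - b' s) *\<^sub>R y s)" for b'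
  proof -
    define z where "z = (\<Sum>s\<in>S. (b s - b' s) *\<^sub>R y s)"
    have "r b' = r b + z"
      by (simp add: r_def z_def scaleR_diff_left sum_subtractf)
    moreover have "r b \<bullet> (A *v z) = 0"
      using orth bil unfolding z_def S_def[symmetric] r_def[symmetric] bilinear_def
      by (simp add: linear_sum[of "\<lambda>y. r b \<bullet> (A *v y)"] linear_cmul[of "\<lambda>y. r b \<bullet> (A *v y)"])
    ultimately show ?thesis
      using sym[of z "r b"] by (simp add: q_def z_def[symmetric] bilinear_ladd[OF bil] bilinear_radd[OF bil])
  qed
  have opt: "linear_regression (distr M borel X) k S 0 b"
    unfolding linear_regression_def risk
  proof (intro allI)
    fix c' b'
    show "q (r b) + 0\<^sup>2 \<le> q (r b') + c'\<^sup>2"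
      using split[of b'] q_pos[of "\<Sum>s\<in>S. (b s - b' s) *\<^sub>R y s"] by simp
  qed
  have uniq: "b' j = b j" if "linear_regression (distr M borel X) k S c b'" for c b'
  proof -
    have "q (r b') + c\<^sup>2 \<le> q (r b) + 0\<^sup>2"
      using that unfolding linear_regression_def risk by blast
    then have "q (\<Sum>s\<in>S. (b s - b' s) *\<^sub>R y s) = 0"
      using split[of b'] q_pos[of "\<Sum>s\<in>S. (b s - b' s) *\<^sub>R y s"] by (smt (verit) zero_le_power2 power_zero_numeral)
    then have "(\<Sum>s\<in>S. (b s - b' s) *\<^sub>R y s) = 0" by (rule q_zero)
    moreover have "(\<Sum>s\<in>S. (b s - b' s) *\<^sub>R y s) = (\<Sum>v\<in>UNIV. (if v \<in> S then b v - b' v else 0) *\<^sub>R y v)"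
      by (intro sum.mono_neutral_cong_left) auto
    ultimately have "(if j \<in> S then b j - b' j else 0) = 0"
      using indep[of "\<lambda>v. if v \<in> S then b v - b' v else 0"] by simp
    then show ?thesis by (simp add: S_def)
  qed
  show ?thesis
    unfolding regression_coeff_def S_def[symmetric]
    using opt uniq by (intro the_equality) blast+
qed

section \<open>Weights of avoiding walks\<close>

definition avoiding_walks :: "'v mixed_graph \<Rightarrow> 'v set \<Rightarrow> 'v \<Rightarrow> 'v \<Rightarrow> 'v walk set" where
  "avoiding_walks G W u v = {w. right_directed_walk G u v w \<and> non_endpoints w \<inter> W = {}}"

lemma right_directed_walk_distinct:
  assumes "acyclic (dir_edges G)" "right_directed_walk G a b w"
  shows "distinct (walk_verts w)"
  using assms(2)
proof (induction w arbitrary: a)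
  case Nil
  then show ?case by (simp add: right_directed_walk_def is_walk_iff)
next
  case (Cons s w)
  have "a \<noteq> x" if "x \<in> tgt ` set (s # w)" for x
  proof (cases "x = tgt (last (s # w))")
    case True
    then have "right_directed_walk G a x (s # w)"
      using Cons.prems by (auto simp: right_directed_walk_def is_walk_iff)
    then show ?thesis
      using assms(1) right_directed_trancl by (metis acyclic_def)
  next
    case False
    then have "x \<in> tgt ` set (butlast (s # w))"
      using that by (metis (no_types, lifting) append_butlast_last_id image_iff list.discI
          rotate1.simps(2) set_ConsD set_rotate1)
    then obtain w1 w2 where "right_directed_walk G a x w1"
      using right_directed_walk_split[OF Cons.prems] by metis
    then show ?thesis
      using assms(1) right_directed_trancl by (metis acyclic_def)
  qed
  moreover have "src s = a" "w \<noteq> [] \<Longrightarrow> right_directed_walk G (tgt s) b w"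
    using Cons.prems by (auto simp: right_directed_walk_def right_directed_def is_walk_Cons split: if_splits)
  moreover have "src (hd w) = tgt s" if "w \<noteq> []"
    using Cons.prems that by (auto simp: right_directed_walk_def is_walk_iff successively_Cons)
  ultimately have "a \<notin> tgt ` set (s # w)" "src s = a"
    "w \<noteq> [] \<Longrightarrow> distinct (tgt s # map tgt w)"
    using Cons.IH[of "tgt s"] unfolding walk_verts_def by (blast, blast, metis)
  then show ?case
    by (cases "w = []") (simp_all add: walk_verts_def)
qed

lemma finite_avoiding_walks:
  fixes G :: "'v::finite mixed_graph"
  assumes "acyclic (dir_edges G)"
  shows "finite (avoiding_walks G W u v)"
proof (rule finite_subset)
  show "avoiding_walks G W u v \<subseteq> {w. set w \<subseteq> UNIV \<times> {Forward} \<times> UNIV \<and> distinct w}"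
    using right_directed_walk_distinct[OF assms]
    by (fastforce simp: avoiding_walks_def right_directed_walk_def right_directed_def walk_verts_def
        distinct_map)
  show "finite {w. set w \<subseteq> (UNIV \<times> {Forward} \<times> UNIV :: 'v step set) \<and> distinct w}"
    by (rule finite_subset_distinct) simp
qed

lemma non_endpoints_Cons:
  "non_endpoints (s # w) = (if w = [] then {} else insert (tgt s) (non_endpoints w))"
  by (simp add: non_endpoints_eq)

text \<open>Split off the first edge: unless it is the whole walk, its target is a non-endpoint and
  so lies outside \<open>W\<close>.\<close>

lemma avoiding_walks_rec:
  "avoiding_walks G W u v =
     (if (u, v) \<in> dir_edges G then {[(u, Forward, v)]} else {}) \<union>
     (\<Union>t\<in>{t. t \<notin> W \<and> (u, t) \<in> dir_edges G}. (#) (u, Forward, t) ` avoiding_walks G W t v)"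
    (is "_ = ?R")
proof (intro equalityI subsetI)
  fix w assume w: "w \<in> avoiding_walks G W u v"
  then obtain s w' where s: "w = s # w'"
    by (cases w) (auto simp: avoiding_walks_def right_directed_walk_def is_walk_iff)
  with w obtain t where t: "s = (u, Forward, t)"
    by (cases s) (auto simp: avoiding_walks_def right_directed_walk_def right_directed_def is_walk_iff)
  from w s t show "w \<in> ?R"
    by (cases "w' = []")
       (auto simp: avoiding_walks_def right_directed_walk_def right_directed_def is_walk_Cons
         non_endpoints_Cons)
next
  fix w assume "w \<in> ?R"
  then show "w \<in> avoiding_walks G W u v"
    by (auto simp: avoiding_walks_def right_directed_walk_def right_directed_def is_walk_Cons
        non_endpoints_Cons split: if_splits)
qed

lemma walks_weight_rec:
  fixes G :: "'v::finite mixed_graph"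
  assumes "acyclic (dir_edges G)"
  shows "walks_weight \<sigma> (avoiding_walks G W u v) = coeff_matrix G \<sigma> $ u $ v +
    (\<Sum>t\<in>-W. coeff_matrix G \<sigma> $ u $ t * walks_weight \<sigma> (avoiding_walks G W t v))"
proof -
  note fin = finite_avoiding_walks[OF assms]
  let ?T = "{t. t \<notin> W \<and> (u, t) \<in> dir_edges G}"
  let ?A = "if (u, v) \<in> dir_edges G then {[(u, Forward, v)]} else {}"
  let ?B = "\<Union>t\<in>?T. (#) (u, Forward, t) ` avoiding_walks G W t v"
  have "[] \<notin> avoiding_walks G W t v" for t
    by (auto simp: avoiding_walks_def right_directed_walk_def is_walk_iff)
  then have "?A \<inter> ?B = {}" by auto
  then have "walks_weight \<sigma> (avoiding_walks G W u v) = sum (walk_weight \<sigma>) ?A + sum (walk_weight \<sigma>) ?B"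
    unfolding walks_weight_def using fin
    by (subst avoiding_walks_rec) (intro sum.union_disjoint; auto)
  also have "sum (walk_weight \<sigma>) ?A = coeff_matrix G \<sigma> $ u $ v"
    by (simp add: walk_weight_def coeff_matrix_def)
  also have "sum (walk_weight \<sigma>) ?B =
      (\<Sum>t\<in>?T. sum (walk_weight \<sigma>) ((#) (u, Forward, t) ` avoiding_walks G W t v))"
    using fin by (intro sum.UNION_disjoint) auto
  also have "\<dots> = (\<Sum>t\<in>?T. coeff_matrix G \<sigma> $ u $ t * walks_weight \<sigma> (avoiding_walks G W t v))"
    by (intro sum.cong refl)
       (simp add: sum.reindex walk_weight_def walks_weight_def sum_distrib_left coeff_matrix_def)
  also have "\<dots> = (\<Sum>t\<in>-W. coeff_matrix G \<sigma> $ u $ t * walks_weight \<sigma> (avoiding_walks G W t v))"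
    by (intro sum.mono_neutral_left) (auto simp: coeff_matrix_def)
  finally show ?thesis .
qed

section \<open>The linear system of the marginal graph\<close>

locale weighted_regression_graph = regression_graph G j k L
  for G :: "'v::finite mixed_graph" and j k :: 'v and L :: "'v set" +
  fixes \<sigma> :: "'v edge \<Rightarrow> real" and y :: "'v \<Rightarrow> real^'v"
  assumes pd: "positive_definite (noise_cov G \<sigma>)"
    and y_eq: "y v = (\<Sum>u\<in>UNIV. coeff_matrix G \<sigma> $ u $ v *\<^sub>R y u) + axis v 1"
begin

abbreviation "\<beta> u v \<equiv> coeff_matrix G \<sigma> $ u $ v"

text \<open>The quantity \<open>total u v\<close> is the coefficient of \<open>u \<rightarrow> v\<close> in the marginal graph, and \<open>noise v\<close>
  represents the marginal noise at \<open>v\<close> as a linear form in the noise of \<open>G\<close>, just as \<open>y v\<close>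
  represents the variable at \<open>v\<close>.\<close>

definition total :: "'v \<Rightarrow> 'v \<Rightarrow> real" where
  "total u v = walks_weight \<sigma> (avoiding_walks G W u v)"

definition noise :: "'v \<Rightarrow> real^'v" where
  "noise v = axis v 1 + (\<Sum>t\<in>-W. total t v *\<^sub>R axis t 1)"

text \<open>The covariance of the linear forms in the noise with coefficient vectors
  \<open>x\<close> and \<open>z\<close>.\<close>

definition cov :: "real^'v \<Rightarrow> real^'v \<Rightarrow> real" where
  "cov x z = x \<bullet> (noise_cov G \<sigma> *v z)"

lemma total_nonzero: "total u v \<noteq> 0 \<Longrightarrow> da u v"
  unfolding total_def walks_weight_def avoiding_walks_def directed_avoiding_def
  by (metis (mono_tags, lifting) mem_Collect_eq sum.neutral)

lemma total_rec: "total u v = \<beta> u v + (\<Sum>t\<in>-W. \<beta> u t * total t v)"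
  unfolding total_def by (rule walks_weight_rec[OF acyclic])

text \<open>Each unit vector in \<open>noise v\<close> is replaced through the structural equations.
  After exchanging sums, \<open>total_rec\<close> cancels the variables outside
  \<open>W\<close>.\<close>

lemma marginal_system: "y v = (\<Sum>u\<in>W. total u v *\<^sub>R y u) + noise v"
proof -
  have ax: "axis t 1 = y t - (\<Sum>u\<in>UNIV. \<beta> u t *\<^sub>R y u)" for t
    using y_eq[of t] by simp
  have rec: "(\<Sum>t\<in>-W. \<beta> u t * total t v) = total u v - \<beta> u v" for u
    using total_rec[of u v] by linarith
  have "(\<Sum>t\<in>-W. total t v *\<^sub>R (\<Sum>u\<in>UNIV. \<beta> u t *\<^sub>R y u)) =
      (\<Sum>u\<in>UNIV. (\<Sum>t\<in>-W. \<beta> u t * total t v) *\<^sub>R y u)"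
    by (simp add: scaleR_sum_right scaleR_sum_left sum.swap[of _ UNIV] mult.commute)
  also have "\<dots> = (\<Sum>u\<in>UNIV. total u v *\<^sub>R y u) - (\<Sum>u\<in>UNIV. \<beta> u v *\<^sub>R y u)"
    unfolding rec by (simp add: scaleR_diff_left sum_subtractf)
  finally have "noise v = y v + (\<Sum>t\<in>-W. total t v *\<^sub>R y t) - (\<Sum>u\<in>UNIV. total u v *\<^sub>R y u)"
    unfolding noise_def ax by (simp add: scaleR_diff_right sum_subtractf)
  moreover have "(\<Sum>u\<in>UNIV. total u v *\<^sub>R y u) =
      (\<Sum>u\<in>W. total u v *\<^sub>R y u) + (\<Sum>t\<in>-W. total t v *\<^sub>R y t)"
    by (subst sum.union_disjoint[symmetric]) (auto simp: Compl_partition)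
  ultimately show ?thesis by simp
qed

lemma cov_bilinear: "bilinear cov"
  unfolding cov_def[abs_def] by (rule bilinear_inner_matrix)

lemma cov_sym: "cov x z = cov z x"
  using pd unfolding cov_def
  by (metis dot_lmul_matrix inner_commute positive_definite_def transpose_matrix_vector)

lemma cov_definite: "cov x x = 0 \<Longrightarrow> x = 0"
  using pd unfolding cov_def positive_definite_def by (metis less_irrefl)

lemma noise_nonzero: "noise v $ x \<noteq> 0 \<Longrightarrow> x = v \<or> x \<notin> W \<and> da x v"
proof -
  assume nz: "noise v $ x \<noteq> 0"
  have "(\<Sum>t\<in>-W. total t v * axis t 1 $ x) = (if x \<in> -W then total x v else 0)"
    by (simp add: axis_def if_distrib[of "(*) _"] cong: if_cong)
  then have "noise v $ x = axis v 1 $ x + (if x \<in> -W then total x v else 0)"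
    by (simp add: noise_def)
  with nz show ?thesis
    using total_nonzero by (auto simp: axis_def split: if_splits)
qed

text \<open>A nonzero term of the double sum gives a bidirected edge \<open>x <-> z\<close> whose
  ends are, or lead outside \<open>W\<close> to, \<open>u\<close> and \<open>v\<close>; together
  these form the trek.\<close>

lemma cov_noise_nonzero:
  assumes "cov (noise u) (noise v) \<noteq> 0"
  shows "ta u v"
proof -
  have "cov (noise u) (noise v) = (\<Sum>x\<in>UNIV. \<Sum>z\<in>UNIV. noise u $ x * (noise_cov G \<sigma> $ x $ z * noise v $ z))"
    by (simp add: cov_def inner_vec_def matrix_vector_mult_def sum_distrib_left)
  with assms obtain x z where "noise u $ x * (noise_cov G \<sigma> $ x $ z * noise v $ z) \<noteq> 0"
    by (metis (mono_tags, lifting) sum.neutral)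
  then have nz: "noise u $ x \<noteq> 0" "noise_cov G \<sigma> $ x $ z \<noteq> 0" "noise v $ z \<noteq> 0" by auto
  then have "ta x z"
    by (auto simp: noise_cov_def split: if_splits intro: trek_avoiding_edge)
  then have "ta u z" using noise_nonzero[OF nz(1)] ta_prepend by metis
  then show ?thesis using noise_nonzero[OF nz(3)] trek_avoiding_append by metis
qed

text \<open>No vertex of \<open>W\<close> is a child of \<open>k\<close> in the marginal graph, so regressing \<open>k\<close> amounts to
  regressing its marginal noise on the marginal noise of \<open>j\<close> and \<open>L\<close>. Only vertices of \<open>L\<close> that are
  not \<open>reached\<close> from \<open>j\<close> contribute, and these are not children of \<open>j\<close>.\<close>

lemma regression_solution:
  assumes sep: separated
  shows "\<exists>b. b j = total j k \<and>
    (\<forall>s\<in>insert j L. cov (y k - (\<Sum>t\<in>insert j L. b t *\<^sub>R y t)) (y s) = 0)"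
proof -
  define S where "S = insert j L"
  define C where "C = {u\<in>L. \<not> reached u}"
  have W: "W = insert k S" "k \<notin> S" "C \<subseteq> S"
    using j_neq_k k_notin by (auto simp: S_def C_def)
  obtain a where a: "\<forall>c\<in>C. cov (noise k - (\<Sum>b\<in>C. a b *\<^sub>R noise b)) (noise c) = 0"
    using projection_coefficients[OF cov_bilinear cov_sym cov_definite finite[of C],
        of "noise k" noise] by blast
  define \<rho> where "\<rho> = noise k - (\<Sum>b\<in>C. a b *\<^sub>R noise b)"
  have lin: "linear (cov x)" "linear (\<lambda>x. cov x z)" for x z
    using cov_bilinear by (auto simp: bilinear_def)
  have total_k: "total k s = 0" if "s \<in> S" for s
    using that sep total_nonzero[of k s] by (auto simp: S_def separated_def)
  have y_S: "y s = (\<Sum>u\<in>S. total u s *\<^sub>R y u) + noise s" if "s \<in> insert k S" for s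
  proof -
    \<comment> \<open>Neither \<open>k\<close> itself nor a vertex of \<open>S\<close> is a child of
      \<open>k\<close>, so \<open>k\<close> drops out of the sum over \<open>W\<close>.\<close>
    have "total k k = 0"
      using total_nonzero[of k k] directed_avoiding_trancl acyclic by (metis acyclic_def)
    then have "total k s = 0" using that total_k by auto
    then show ?thesis
      by (subst marginal_system) (simp only: W(1), simp add: W(2))
  qed
  have \<rho>_noise: "cov \<rho> (noise s) = 0" if "s \<in> S" for s
  proof (cases "s \<in> C")
    case True
    then show ?thesis using a by (simp add: \<rho>_def)
  next
    case False
    then have s: "s = j \<or> reached s" using that by (auto simp: S_def C_def)
    have "cov (noise k) (noise s) = 0"
      using sep s cov_noise_nonzero ta_sym by (metis separated_def)
    moreover have "cov (noise c) (noise s) = 0" if "c \<in> C" for c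
    proof (rule ccontr)
      assume "cov (noise c) (noise s) \<noteq> 0"
      then have "ta s c" using cov_noise_nonzero ta_sym by metis
      then have "reached c" using s that reached.intros unfolding C_def by blast
      then show False using that by (simp add: C_def)
    qed
    ultimately show ?thesis
      by (simp add: \<rho>_def linear_diff[OF lin(2)] linear_sum[OF lin(2)] linear_cmul[OF lin(2)])
  qed
  \<comment> \<open>Orthogonality passes from the noises to the variables by induction along
    ancestors: \<open>y s\<close> is \<open>noise s\<close> plus a combination of the
    \<open>y u\<close>, with nonzero coefficients only for proper ancestors
    \<open>u\<close>.\<close>
  have "wf ((dir_edges G)\<^sup>+)"
    using acyclic by (intro wf_trancl finite_acyclic_wf) auto
  then have \<rho>_y: "s \<in> S \<longrightarrow> cov \<rho> (y s) = 0" for s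
  proof (induction s rule: wf_induct_rule)
    case (less s)
    show ?case
    proof
      assume s: "s \<in> S"
      have "total u s * cov \<rho> (y u) = 0" if "u \<in> S" for u
        using less that total_nonzero directed_avoiding_trancl by (metis mult_eq_0_iff)
      with s show "cov \<rho> (y s) = 0"
        by (subst y_S) (auto simp: \<rho>_noise linear_add[OF lin(1)] linear_sum[OF lin(1)]
            linear_cmul[OF lin(1)] intro!: sum.neutral)
    qed
  qed
  \<comment> \<open>Found by writing each noise in \<open>\<rho>\<close> through the variables and
    collecting the coefficient of \<open>y u\<close>. At \<open>j\<close> only
    \<open>total j k\<close> remains, since \<open>j\<close> is not in \<open>C\<close> and has no
    child there.\<close>
  define b where "b u = total u k + (if u \<in> C then a u else 0) - (\<Sum>c\<in>C. a c * total u c)" for u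
  have "(\<Sum>c\<in>C. a c *\<^sub>R noise c) = (\<Sum>c\<in>C. a c *\<^sub>R (y c - (\<Sum>u\<in>S. total u c *\<^sub>R y u)))"
    using y_S W(3) by (intro sum.cong) (auto simp: algebra_simps)
  also have "\<dots> = (\<Sum>c\<in>C. a c *\<^sub>R y c) - (\<Sum>u\<in>S. (\<Sum>c\<in>C. a c * total u c) *\<^sub>R y u)"
    by (simp add: scaleR_diff_right sum_subtractf scaleR_sum_right scaleR_sum_left sum.swap[of _ S])
  also have "(\<Sum>c\<in>C. a c *\<^sub>R y c) = (\<Sum>u\<in>S. (if u \<in> C then a u else 0) *\<^sub>R y u)"
    using W(3) by (intro sum.mono_neutral_cong_left) auto
  finally have "\<rho> = y k - (\<Sum>u\<in>S. b u *\<^sub>R y u)"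
    using y_S[of k] unfolding \<rho>_def b_def
    by (simp add: scaleR_diff_left scaleR_add_left sum_subtractf sum.distrib algebra_simps)
  moreover have "total j c = 0" if "c \<in> C" for c
    using that total_nonzero[of j c] reached.direct[of c] by (auto simp: C_def)
  then have "b j = total j k"
    using j_notin by (simp add: b_def C_def)
  ultimately show ?thesis
    using \<rho>_y unfolding S_def by blast
qed

end

section \<open>Identification of the regression coefficient\<close>

theorem theorem5:
  fixes G :: "'v::finite mixed_graph"
    and \<sigma> :: "'v edge \<Rightarrow> real"
    and M :: "'m measure"
    and X E :: "'m \<Rightarrow> real ^ 'v"
    and P :: "(real ^ 'v) measure"
    and j k :: 'v
    and L :: "'v set"
  assumes "mixed_graph G" and "verts G = UNIV"
    and "canonical G" and "acyclic_graph G"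
    and "gaussian_linear_system G \<sigma> M X E" and "non_singular G \<sigma>"
    and "positive_definite (noise_cov G \<sigma>)"
    and "P = distr M borel X"
    and "j \<in> verts G" and "k \<in> verts G" and "L \<subseteq> verts G"
    and "j \<noteq> k" and "j \<notin> L" and "k \<notin> L"
  defines "Vt \<equiv> {j, k} \<union> L"
  defines "Gt \<equiv> marginal_graph G Vt"
  defines "cond_a \<equiv> (\<forall>w. is_path Gt j k w \<and> \<not> blocked L w \<longrightarrow> w = [(j, Forward, k)])"
    and "cond_b \<equiv> \<not> (\<exists>m\<in>L. \<exists>w. right_directed_walk Gt k m w)"
  defines "cond_1 \<equiv> (\<forall>w. is_path G j k w \<and> \<not> ancestrally_blocked G L w \<longrightarrow> right_directed w)"
    and "cond_2 \<equiv> \<not> (\<exists>m\<in>L. \<exists>w. right_directed_walk G k m w)"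
    and "cond_3 \<equiv> \<not> (\<exists>l\<in>verts G - Vt.
           (\<exists>w. right_directed_walk G j k w \<and> l \<in> non_endpoints w \<and> \<not> blocked L w) \<and>
           (\<exists>m\<in>L. \<exists>w. right_directed_walk G l m w))"
  shows "(cond_a \<and> cond_b \<longleftrightarrow> cond_1 \<and> cond_2 \<and> cond_3) \<and>
    (cond_1 \<and> cond_2 \<and> cond_3 \<longrightarrow>
       regression_coeff P k j L =
         walks_weight \<sigma> {w. is_path G j k w \<and> right_directed w \<and> \<not> blocked L w})"
proof -
  interpret regression_graph G j k L
  proof
    show "sym (bidir_edges G)" using assms(1) by (simp add: mixed_graph_def)
    show "\<And>a. (a, a) \<in> bidir_edges G" using assms(2,3) by (simp add: canonical_def)
    show "acyclic (dir_edges G)" using assms(4) by (simp add: acyclic_graph_iff)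
  qed (use assms in auto)
  have c2: "cond_2 \<longleftrightarrow> (\<forall>m\<in>L. (k, m) \<notin> (dir_edges G)\<^sup>+)"
    unfolding cond_2_def ex_right_directed_walk by blast
  have b: "cond_b \<longleftrightarrow> (\<forall>m\<in>L. (k, m) \<notin> (dir_edges Gt)\<^sup>+)"
    unfolding cond_b_def ex_right_directed_walk by blast
  have ab_sep: separated if "cond_a" "cond_b"
    using that unfolding cond_a_def cond_b_def Gt_def Vt_def by (intro separatedI) blast+
  have sep_123: "cond_1 \<and> cond_2 \<and> cond_3" if separated
  proof (intro conjI)
    show cond_1
      unfolding cond_1_def using separated_right_directed[OF that] by blast
    show cond_2
      unfolding c2 using separated_not_ancestor[OF that] by blast
    show cond_3
      unfolding cond_3_def ex_right_directed_walk Vt_def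
      using separated_no_ancestor_on_causal_path[OF that] by blast
  qed
  have ab: "cond_a \<and> cond_b" if "cond_1" "cond_2" "cond_3"
  proof
    show cond_b
      using that(2) trancl_marginal unfolding b c2 Gt_def Vt_def by blast
    show cond_a
      unfolding cond_a_def Gt_def Vt_def
    proof (intro allI impI)
      fix w assume w: "is_path (marginal_graph G ({j, k} \<union> L)) j k w \<and> \<not> blocked L w"
      show "w = [(j, Forward, k)]"
      proof (rule unblocked_marginal_path)
        fix w assume "is_path G j k w" "\<not> ancestrally_blocked G L w"
        then show "right_directed w" using that(1) unfolding cond_1_def by blast
      next
        fix l w m
        assume "l \<notin> {j, k} \<union> L" "right_directed_walk G j k w" "l \<in> non_endpoints w"
          "\<not> blocked L w" "m \<in> L"
        then show "(l, m) \<notin> (dir_edges G)\<^sup>+"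
          using that(3) assms(2) unfolding cond_3_def ex_right_directed_walk Vt_def by blast
      qed (use w in auto)
    qed
  qed
  have "regression_coeff P k j L =
      walks_weight \<sigma> {w. is_path G j k w \<and> right_directed w \<and> \<not> blocked L w}" if sep: separated
  proof -
    let ?B = "coeff_matrix G \<sigma>"
    obtain N where N: "(mat 1 - ?B) ** N = mat 1" "N ** (mat 1 - ?B) = mat 1"
      using \<open>non_singular G \<sigma>\<close> unfolding non_singular_def invertible_def by blast
    \<comment> \<open>Column \<open>v\<close> of the inverse is the coefficient vector of component
      \<open>v\<close> of \<open>X\<close> in the noise, because \<open>X\<close> is the transpose
      of \<open>N\<close> applied to \<open>E\<close>.\<close>
    define y where "y v = column v N" for v
    interpret weighted_regression_graph G j k L \<sigma> y
    proof
      show "positive_definite (noise_cov G \<sigma>)" by fact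
      show "y v = (\<Sum>u\<in>UNIV. ?B $ u $ v *\<^sub>R y u) + axis v 1" for v
        unfolding vec_eq_iff
      proof
        fix w
        have "(N ** (mat 1 - ?B)) $ w $ v = axis v 1 $ w"
          using N(2) by (simp add: mat_def axis_def)
        moreover have "(N ** (mat 1 - ?B)) $ w $ v = N $ w $ v - (\<Sum>u\<in>UNIV. ?B $ u $ v * N $ w $ u)"
          by (simp add: matrix_matrix_mult_def mat_def right_diff_distrib sum_subtractf mult.commute
              if_distrib[of "\<lambda>x. x * _"] if_distrib[of "(*) _"] cong: if_cong)
        ultimately show "y v $ w = ((\<Sum>u\<in>UNIV. ?B $ u $ v *\<^sub>R y u) + axis v 1) $ w"
          by (simp add: y_def column_def)
      qed
    qed
    note sys = \<open>gaussian_linear_system G \<sigma> M X E\<close>[unfolded gaussian_linear_system_def]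
    obtain b where b: "b j = total j k"
      "\<forall>s\<in>insert j L. cov (y k - (\<Sum>t\<in>insert j L. b t *\<^sub>R y t)) (y s) = 0"
      using regression_solution[OF sep] by blast
    have "regression_coeff (distr M borel X) k j L = b j"
    proof (rule regression_coeff_eqI[where E = E and A = "noise_cov G \<sigma>" and y = y])
      show "X \<omega> $ v = y v \<bullet> E \<omega>" if "\<omega> \<in> space M" for \<omega> v
      proof -
        have "E \<omega> = X \<omega> - transpose ?B *v X \<omega>"
          using sys that by (metis add_diff_cancel_left')
        also have "\<dots> = (mat 1 - transpose ?B) *v X \<omega>"
          by (simp only: matrix_vector_mult_diff_rdistrib matrix_vector_mul_lid)
        also have "mat 1 - transpose ?B = transpose (mat 1 - ?B)"
          by (auto simp: vec_eq_iff transpose_def mat_def)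
        finally have "E \<omega> = transpose (mat 1 - ?B) *v X \<omega>" .
        then have "transpose N *v E \<omega> = transpose ((mat 1 - ?B) ** N) *v X \<omega>"
          by (simp only: matrix_vector_mul_assoc matrix_transpose_mul)
        then have "X \<omega> = transpose N *v E \<omega>" by (simp only: N(1) transpose_mat matrix_vector_mul_lid)
        then show ?thesis
          by (simp add: y_def matrix_vector_mult_def inner_vec_def column_def transpose_def)
      qed
      show "\<forall>v. d v = 0" if "(\<Sum>v\<in>UNIV. d v *\<^sub>R y v) = 0" for d
      proof -
        have "N *v (\<chi> v. d v) = 0"
          using that by (simp add: matrix_mult_sum y_def scalar_mult_eq_scaleR)
        then have "(\<chi> v. d v) = 0"
          using N(1) by (metis matrix_vector_mul_assoc matrix_vector_mul_lid matrix_vector_mult_0_right)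
        then show ?thesis by (simp add: vec_eq_iff)
      qed
    qed (use sys b pd in \<open>auto simp: cov_def\<close>)
    \<comment> \<open>Acyclicity makes right-directed walks paths and keeps \<open>j\<close> and
      \<open>k\<close> out of their interior, so avoiding \<open>W\<close> amounts to not being
      blocked by \<open>L\<close>.\<close>
    moreover have "avoiding_walks G W j k = {w. is_path G j k w \<and> right_directed w \<and> \<not> blocked L w}"
      (is "_ = ?R")
    proof (intro equalityI subsetI)
      fix w assume w: "w \<in> avoiding_walks G W j k"
      then have "right_directed_walk G j k w" "tgt ` set (butlast w) \<inter> L = {}"
        by (auto simp: avoiding_walks_def non_endpoints_eq)
      then show "w \<in> ?R"
        using right_directed_walk_distinct[OF acyclic] right_directed_not_blocked_iff[of w L]
        unfolding is_path_def right_directed_walk_def mem_Collect_eq by blast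
    next
      fix w assume w: "w \<in> ?R"
      then have *: "right_directed_walk G j k w" "tgt ` set (butlast w) \<inter> L = {}"
        using right_directed_not_blocked_iff[of w L]
        unfolding is_path_def right_directed_walk_def mem_Collect_eq by blast+
      then show "w \<in> avoiding_walks G W j k"
        using right_directed_walk_endpoint[OF *(1)] unfolding avoiding_walks_def non_endpoints_eq by blast
    qed
    ultimately show ?thesis
      using b(1) \<open>P = distr M borel X\<close> by (simp add: total_def)
  qed
  with ab_sep sep_123 ab show ?thesis by blast
qed

end
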